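(* Let $((\Omega_i, \Sigma_i, \mathbb P_i))_{i=1}^n$ be probability spaces with product space $(\Omega, \Sigma, \mathbb P)$, let $\Omega^* \subseteq \Omega$ be a set of exceptional outcomes, let $X : \Omega \rightarrow \mathbb R_{\geq0}$ be a non-negative random variable, and let $r,d \geq 0$. If $X$ is $(r,d)$-observable with respect to $\Omega^*$, then for any $t > 96\sqrt{rd\,\mathbb{E}[X]} + 128rd + 8\,\mathbb{P}[\Omega^*](\sup X)$, $$\mathbb{P}\left[|X - \mathbb{E}[X]| > t\right] \leq 4\exp\left({\frac{-t^2}{8rd(4\mathbb{E}[X] + t)}}\right) + 4\,\mathbb{P}[\Omega^*].$$
   Context: Let $\omega=(\omega_1,\ldots,\omega_n)\in\Omega$ and $s>0$. An $(r,d)$-certificate for $X,\omega,s$ and $\Omega^*$ is an index set $I\subseteq\{1,\ldots,n\}$ and a vector $(c_i:i\in I)$ of reals with $\sum_{i\in I}c_i\le rs$ and $\max_{i\in I}c_i\le d$ such that for every $I'\subseteq I$ and every $\omega'=(\omega'_1,\ldots,\omega'_n)\in\Omega\setminus\Omega^*$ with $\omega'_i=\omega_i$ for all $i\in I\setminus I'$, we have $X(\omega')\ge s-\sum_{i\in I'}c_i$. $X$ is $(r,d)$-observable with respect to $\Omega^*$ if for every $s>0$ and every $\omega\in\Omega\setminus\Omega^*$ with $X(\omega)\ge s$ there exists an $(r,d)$-certificate for $X,\omega,s,\Omega^*$. *)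

theory Defs
  imports "HOL-Probability.Probability"
begin

text \<open>
  Outcomes are functions on \<open>{1..n}\<close> and \<open>\<Omega>\<close> is the product of the sample spaces.  The maximum
  over an empty index set is read as no constraint, so the second condition is pointwise.
  The \<open>c i\<close> may be negative; values of \<open>c\<close> outside \<open>I\<close> are irrelevant.
\<close>

definition certificate ::
  "nat \<Rightarrow> (nat \<Rightarrow> 'a) set \<Rightarrow> (nat \<Rightarrow> 'a) set \<Rightarrow> ((nat \<Rightarrow> 'a) \<Rightarrow> real) \<Rightarrow> real \<Rightarrow> real \<Rightarrow>
   (nat \<Rightarrow> 'a) \<Rightarrow> real \<Rightarrow> nat set \<Rightarrow> (nat \<Rightarrow> real) \<Rightarrow> bool" where
  "certificate n \<Omega> \<Omega>x X r d \<omega> s I c \<longleftrightarrow>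
     I \<subseteq> {1..n} \<and>
     (\<Sum>i\<in>I. c i) \<le> r * s \<and>
     (\<forall>i\<in>I. c i \<le> d) \<and>
     (\<forall>I' \<subseteq> I. \<forall>\<omega>' \<in> \<Omega> - \<Omega>x. (\<forall>i \<in> I - I'. \<omega>' i = \<omega> i) \<longrightarrow> X \<omega>' \<ge> s - (\<Sum>i\<in>I'. c i))"

definition observable ::
  "nat \<Rightarrow> (nat \<Rightarrow> 'a) set \<Rightarrow> (nat \<Rightarrow> 'a) set \<Rightarrow> ((nat \<Rightarrow> 'a) \<Rightarrow> real) \<Rightarrow> real \<Rightarrow> real \<Rightarrow> bool" where
  "observable n \<Omega> \<Omega>x X r d \<longleftrightarrow>
     (\<forall>s > 0. \<forall>\<omega> \<in> \<Omega> - \<Omega>x. X \<omega> \<ge> s \<longrightarrow> (\<exists>I c. certificate n \<Omega> \<Omega>x X r d \<omega> s I c))"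

text \<open>
  \<open>exp (- a / b)\<close> for \<open>a > 0\<close> and \<open>b \<ge> 0\<close>, where \<open>- a / 0\<close> means \<open>-\<infinity>\<close>.  HOL's \<open>x / 0 = 0\<close> would
  instead give the value \<open>1\<close> at \<open>b = 0\<close> and make a tail bound vacuous there.
\<close>

definition exp_neg_quot :: "real \<Rightarrow> real \<Rightarrow> real" where
  "exp_neg_quot a b = (if b = 0 then 0 else exp (- a / b))"

text \<open>
  The supremum is taken in the extended reals because \<open>X\<close> need not be bounded; in \<open>ereal\<close>
  the product of \<open>0\<close> and \<open>\<infinity>\<close> is \<open>0\<close>.
\<close>

definition sup_over :: "'b set \<Rightarrow> ('b \<Rightarrow> real) \<Rightarrow> ereal" where
  "sup_over \<Omega> X = (SUP \<omega>\<in>\<Omega>. ereal (X \<omega>))"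

end

theory Submission
  imports Defs
begin

text \<open>
  A certificate of \<open>X \<omega> \<ge> s\<close> shows that \<open>\<omega>\<close> has squared convex distance at least
  \<open>(s - a)\<^sup>2 / (r * d * s)\<close> from \<open>{X \<le> a} - \<Omega>\<^sup>*\<close>, so Talagrand's inequality bounds the
  product of the probabilities of \<open>{X \<le> a}\<close> and \<open>{X \<ge> s}\<close> outside \<open>\<Omega>\<^sup>*\<close>.  With \<open>a\<close> or \<open>s\<close> a
  median this is a tail bound around the median.  Integrating it puts the expectation within \<open>t / 4\<close>
  of the median, the contribution of \<open>\<Omega>\<^sup>*\<close> being at most \<open>P[\<Omega>\<^sup>*] * sup X\<close>, and the slack in
  the exponent absorbs the change of centre.  The case \<open>r * d = 0\<close> follows by letting
  \<open>r + \<epsilon>\<close> and \<open>d + \<epsilon>\<close> tend to \<open>r\<close> and \<open>d\<close>.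
\<close>

text \<open>The distance bound comes from a linear inequality. For nonnegative weights, take as
  \<open>I'\<close> the coordinates where \<open>\<omega>\<close> disagrees with a point of
  \<open>{X \<le> a} - \<Omega>x\<close>: their weights sum to at least \<open>s - a\<close>. Being
  linear in the disagreement vector, this passes to the convex hull, and Cauchy-Schwarz with
  \<open>(\<Sum>i\<in>I. (c i)\<^sup>2) \<le> d * (\<Sum>i\<in>I. c i) \<le> r * d * s\<close> turns
  it into the distance.

  The constants arise as follows. If the exceptional set has probability above 1/4, the claim is
  trivial. Otherwise each half-line ending at a median keeps probability at least 1/4 outside
  \<open>\<Omega>x\<close>, so the two tails around the median carry a total factor 8. Moving to the
  mean costs \<open>t / 4\<close>, so the tail is evaluated at \<open>3 * t / 4\<close>. Even there
  the exponent beats the claimed one by a factor 9/8, and the lower bound on \<open>t\<close> makes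
  this surplus at least 1, which reduces 8 to 4.\<close>

section \<open>Talagrand's convex distance inequality\<close>

text \<open>\<open>disagreement x A\<close> is the convex hull of the vectors marking the coordinates in which \<open>x\<close> differs from
  a point of \<open>A\<close>; its squared distance to \<open>0\<close> is the dual form of Talagrand's convex distance.\<close>
inductive disagreement :: "('i \<Rightarrow> 'a) \<Rightarrow> ('i \<Rightarrow> 'a) set \<Rightarrow> ('i \<Rightarrow> real) \<Rightarrow> bool" for x A where
  point: "y \<in> A \<Longrightarrow> disagreement x A (\<lambda>i. of_bool (x i \<noteq> y i))"
| convex: "disagreement x A v \<Longrightarrow> disagreement x A w \<Longrightarrow> 0 \<le> \<theta> \<Longrightarrow> \<theta> \<le> 1 \<Longrightarrow>
    disagreement x A (\<lambda>i. \<theta> * v i + (1 - \<theta>) * w i)"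

text \<open>\<open>K\<close> enters only through the sum, so a vector for a section of
  \<open>A\<close> over \<open>K\<close> becomes one for \<open>A\<close> over
  \<open>insert k K\<close> by changing its entry at \<open>k\<close>.\<close>

definition convex_dist_sq :: "'i set \<Rightarrow> ('i \<Rightarrow> 'a) set \<Rightarrow> ('i \<Rightarrow> 'a) \<Rightarrow> real" where
  "convex_dist_sq K A x = (INF v\<in>Collect (disagreement x A). \<Sum>i\<in>K. (v i)\<^sup>2)"

lemma bdd_below_sum_squares: "bdd_below ((\<lambda>v. \<Sum>i\<in>K. (v i :: real)\<^sup>2) ` V)"
  by (rule bdd_belowI2[of _ 0]) (simp add: sum_nonneg)

lemma convex_dist_sq_le: "disagreement x A v \<Longrightarrow> convex_dist_sq K A x \<le> (\<Sum>i\<in>K. (v i)\<^sup>2)"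
  unfolding convex_dist_sq_def by (rule cINF_lower[OF bdd_below_sum_squares]) simp

lemma convex_dist_sq_ge:
  assumes "A \<noteq> {}" "\<And>v. disagreement x A v \<Longrightarrow> b \<le> (\<Sum>i\<in>K. (v i)\<^sup>2)"
  shows "b \<le> convex_dist_sq K A x"
  unfolding convex_dist_sq_def using assms by (intro cINF_greatest) (auto intro: point)

lemma convex_dist_sq_approx:
  assumes "A \<noteq> {}" "\<epsilon> > 0"
  obtains v where "disagreement x A v" "(\<Sum>i\<in>K. (v i)\<^sup>2) < convex_dist_sq K A x + \<epsilon>"
proof -
  have "Collect (disagreement x A) \<noteq> {}"
    using assms(1) by (auto intro: point)
  then have "\<exists>v\<in>Collect (disagreement x A). (\<Sum>i\<in>K. (v i)\<^sup>2) < convex_dist_sq K A x + \<epsilon>"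
    using assms(2) cINF_less_iff[OF _ bdd_below_sum_squares, of "Collect (disagreement x A)"]
    unfolding convex_dist_sq_def by (metis less_add_same_cancel1)
  with that show ?thesis by auto
qed

section \<open>Sections in one coordinate\<close>

lemma disagreement_same_coord:
  assumes "disagreement x {x \<in> S. x(k := \<omega>) \<in> A} v"
  shows "disagreement (x(k := \<omega>)) A (v(k := 0))"
  using assms
proof induction
  case (point y)
  have eq: "(\<lambda>i. of_bool (x i \<noteq> y i))(k := 0) = (\<lambda>i. of_bool ((x(k := \<omega>)) i \<noteq> (y(k := \<omega>)) i) :: real)"
    by auto
  have "y(k := \<omega>) \<in> A"
    using point by simp
  then show ?case
    unfolding eq by (rule disagreement.point)
next
  case (convex v w \<theta>)
  have "(\<lambda>i. \<theta> * v i + (1 - \<theta>) * w i)(k := 0) = (\<lambda>i. \<theta> * (v(k := 0)) i + (1 - \<theta>) * (w(k := 0)) i)"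
    by auto
  then show ?case
    using disagreement.convex[OF convex.IH convex.hyps(3,4)] by simp
qed

text \<open>All points of the section over \<open>\<omega>'\<close> receive the same entry at
  \<open>k\<close>, so that entry is unchanged by convex combinations.\<close>

lemma disagreement_other_coord:
  assumes "disagreement x {x \<in> S. x(k := \<omega>') \<in> A} v"
  shows "disagreement (x(k := \<omega>)) A (v(k := of_bool (\<omega> \<noteq> \<omega>')))"
  using assms
proof induction
  case (point y)
  have eq: "(\<lambda>i. of_bool (x i \<noteq> y i))(k := of_bool (\<omega> \<noteq> \<omega>')) =
      (\<lambda>i. of_bool ((x(k := \<omega>)) i \<noteq> (y(k := \<omega>')) i) :: real)"
    by auto
  have "y(k := \<omega>') \<in> A"
    using point by simp
  then show ?case
    unfolding eq by (rule disagreement.point)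
next
  case (convex v w \<theta>)
  let ?b = "of_bool (\<omega> \<noteq> \<omega>') :: real"
  have "(\<lambda>i. \<theta> * v i + (1 - \<theta>) * w i)(k := ?b) = (\<lambda>i. \<theta> * (v(k := ?b)) i + (1 - \<theta>) * (w(k := ?b)) i)"
    by (auto simp: algebra_simps)
  then show ?case
    using disagreement.convex[OF convex.IH convex.hyps(3,4)] by simp
qed

lemma square_convex_comb_le:
  fixes a b \<theta> :: real
  assumes "0 \<le> \<theta>" "\<theta> \<le> 1"
  shows "(\<theta> * a + (1 - \<theta>) * b)\<^sup>2 \<le> \<theta> * a\<^sup>2 + (1 - \<theta>) * b\<^sup>2"
proof -
  have "\<theta> * a\<^sup>2 + (1 - \<theta>) * b\<^sup>2 - (\<theta> * a + (1 - \<theta>) * b)\<^sup>2 = \<theta> * (1 - \<theta>) * (a - b)\<^sup>2"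
    by (simp add: power2_eq_square algebra_simps)
  also have "\<dots> \<ge> 0"
    using assms by simp
  finally show ?thesis by simp
qed

text \<open>Mix a near-minimiser of the section over \<open>\<omega>\<close> itself, which costs
  nothing in coordinate \<open>k\<close>, with one of another section, which costs at most 1 there.
  With weight \<open>1 - \<theta>\<close> on the latter the entry at \<open>k\<close> is at most
  \<open>1 - \<theta>\<close>; the other coordinates are handled by convexity of the square.\<close>

lemma convex_dist_sq_insert_le:
  fixes A S :: "('i \<Rightarrow> 'a) set" and k :: 'i
  defines "sec \<equiv> \<lambda>\<omega>. {x \<in> S. x(k := \<omega>) \<in> A}"
  assumes K: "finite K" "k \<notin> K" and \<theta>: "0 \<le> \<theta>" "\<theta> \<le> 1"
    and ne: "sec \<omega> \<noteq> {}" "sec \<omega>' \<noteq> {}"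
  shows "convex_dist_sq (insert k K) A (x(k := \<omega>)) \<le>
    \<theta> * convex_dist_sq K (sec \<omega>) x + (1 - \<theta>) * convex_dist_sq K (sec \<omega>') x + (1 - \<theta>)\<^sup>2"
proof (rule field_le_epsilon)
  fix \<epsilon> :: real assume "\<epsilon> > 0"
  obtain v where v: "disagreement x (sec \<omega>) v" "(\<Sum>i\<in>K. (v i)\<^sup>2) < convex_dist_sq K (sec \<omega>) x + \<epsilon>"
    by (rule convex_dist_sq_approx[OF ne(1) \<open>\<epsilon> > 0\<close>])
  obtain w where w: "disagreement x (sec \<omega>') w" "(\<Sum>i\<in>K. (w i)\<^sup>2) < convex_dist_sq K (sec \<omega>') x + \<epsilon>"
    by (rule convex_dist_sq_approx[OF ne(2) \<open>\<epsilon> > 0\<close>])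
  define b :: real where "b = of_bool (\<omega> \<noteq> \<omega>')"
  define z where "z = (\<lambda>i. \<theta> * (v(k := 0)) i + (1 - \<theta>) * (w(k := b)) i)"
  have "disagreement (x(k := \<omega>)) A z"
    unfolding z_def b_def
    by (rule disagreement.convex[OF disagreement_same_coord disagreement_other_coord \<theta>])
      (use v w in \<open>auto simp: sec_def\<close>)
  then have "convex_dist_sq (insert k K) A (x(k := \<omega>)) \<le> (z k)\<^sup>2 + (\<Sum>i\<in>K. (z i)\<^sup>2)"
    using convex_dist_sq_le[of "x(k := \<omega>)" A z "insert k K"] K by simp
  also have "(z k)\<^sup>2 \<le> (1 - \<theta>)\<^sup>2"
    by (simp add: z_def b_def)
  also have "(\<Sum>i\<in>K. (z i)\<^sup>2) \<le> (\<Sum>i\<in>K. \<theta> * (v i)\<^sup>2 + (1 - \<theta>) * (w i)\<^sup>2)"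
    using K by (intro sum_mono) (auto simp: z_def intro!: square_convex_comb_le \<theta>)
  also have "\<dots> = \<theta> * (\<Sum>i\<in>K. (v i)\<^sup>2) + (1 - \<theta>) * (\<Sum>i\<in>K. (w i)\<^sup>2)"
    by (simp add: sum.distrib sum_distrib_left)
  also have "\<dots> \<le> \<theta> * (convex_dist_sq K (sec \<omega>) x + \<epsilon>) + (1 - \<theta>) * (convex_dist_sq K (sec \<omega>') x + \<epsilon>)"
    using v w \<theta> by (intro add_mono mult_left_mono) auto
  finally show "convex_dist_sq (insert k K) A (x(k := \<omega>)) \<le>
      \<theta> * convex_dist_sq K (sec \<omega>) x + (1 - \<theta>) * convex_dist_sq K (sec \<omega>') x + (1 - \<theta>)\<^sup>2 + \<epsilon>"
    by (simp add: algebra_simps del: fun_upd_apply)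
qed

text \<open>The case \<theta> = 0 of the previous recursion, for points whose own section may be
  empty.\<close>

lemma convex_dist_sq_insert_le':
  fixes A S :: "('i \<Rightarrow> 'a) set" and k :: 'i
  defines "sec \<equiv> \<lambda>\<omega>. {x \<in> S. x(k := \<omega>) \<in> A}"
  assumes K: "finite K" "k \<notin> K" and ne: "sec \<omega>' \<noteq> {}"
  shows "convex_dist_sq (insert k K) A (x(k := \<omega>)) \<le> convex_dist_sq K (sec \<omega>') x + 1"
proof (rule field_le_epsilon)
  fix \<epsilon> :: real assume "\<epsilon> > 0"
  obtain w where w: "disagreement x (sec \<omega>') w" "(\<Sum>i\<in>K. (w i)\<^sup>2) < convex_dist_sq K (sec \<omega>') x + \<epsilon>"
    by (rule convex_dist_sq_approx[OF ne(1) \<open>\<epsilon> > 0\<close>])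
  define z where "z = w(k := of_bool (\<omega> \<noteq> \<omega>'))"
  have "disagreement (x(k := \<omega>)) A z"
    unfolding z_def by (rule disagreement_other_coord) (use w in \<open>auto simp: sec_def\<close>)
  then have "convex_dist_sq (insert k K) A (x(k := \<omega>)) \<le> (z k)\<^sup>2 + (\<Sum>i\<in>K. (z i)\<^sup>2)"
    using convex_dist_sq_le[of "x(k := \<omega>)" A z "insert k K"] K by simp
  also have "(z k)\<^sup>2 \<le> 1"
    by (simp add: z_def)
  also have "(\<Sum>i\<in>K. (z i)\<^sup>2) = (\<Sum>i\<in>K. (w i)\<^sup>2)"
    using K by (intro sum.cong) (auto simp: z_def)
  finally show "convex_dist_sq (insert k K) A (x(k := \<omega>)) \<le> convex_dist_sq K (sec \<omega>') x + 1 + \<epsilon>"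
    using w by linarith
qed

section \<open>The scalar inequality of the induction step\<close>

text \<open>With \<open>l = - ln \<rho>\<close> and \<open>\<theta> = 1 - 2 * l\<close> the
  expression minimised in \<open>talagrand_scalar\<close> equals \<open>l - l\<^sup>2\<close>.
  Equality holds at 0, and the derivative is nonpositive for \<open>l \<ge> 0\<close>.\<close>

lemma exp_sub_square_add_exp_neg_le:
  fixes l :: real
  assumes "0 \<le> l"
  shows "exp (l - l\<^sup>2) + exp (- l) \<le> 2"
proof -
  let ?f = "\<lambda>l::real. exp (l - l\<^sup>2) + exp (- l)"
  have "?f l \<le> ?f 0"
  proof (rule DERIV_nonpos_imp_nonincreasing[OF assms])
    fix x :: real assume "0 \<le> x" "x \<le> l"
    have "((\<lambda>l. exp (l - l\<^sup>2) + exp (- l)) has_real_derivative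
        (1 - 2 * x) * exp (x - x\<^sup>2) - exp (- x)) (at x)"
      by (auto intro!: derivative_eq_intros)
    moreover have "(1 - 2 * x) * exp (x - x\<^sup>2) \<le> exp (- x)"
    proof -
      have "1 - 2 * x \<le> 1 + (x\<^sup>2 - 2 * x)" by simp
      also have "\<dots> \<le> exp (x\<^sup>2 - 2 * x)" by (rule exp_ge_add_one_self)
      finally have "(1 - 2 * x) * exp (x - x\<^sup>2) \<le> exp (x\<^sup>2 - 2 * x) * exp (x - x\<^sup>2)"
        by (intro mult_right_mono) auto
      also have "\<dots> = exp (- x)"
        by (simp flip: exp_add)
      finally show ?thesis .
    qed
    ultimately show "\<exists>y. ((\<lambda>l. exp (l - l\<^sup>2) + exp (- l)) has_real_derivative y) (at x) \<and> y \<le> 0"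
      by force
  qed
  then show ?thesis by simp
qed

text \<open>This and the next bound settle small \<open>\<rho>\<close>, where the best \<theta> is
  0: they leave exactly 4/3 + 2/3 = 2.\<close>

lemma exp_quarter_le: "exp (1 / 4 :: real) \<le> 4 / 3"
proof -
  have "1 + (- (1 / 4)) \<le> exp (- (1 / 4) :: real)"
    by (rule exp_ge_add_one_self)
  then show ?thesis
    by (simp add: exp_minus field_simps)
qed

lemma exp_neg_half_le: "exp (- (1 / 2) :: real) \<le> 2 / 3"
proof -
  have "1 + 1 / 2 \<le> exp (1 / 2 :: real)"
    by (rule exp_ge_add_one_self)
  then show ?thesis
    by (simp add: exp_minus field_simps)
qed

text \<open>The witness \<open>\<theta> = max 0 (1 + 2 * ln \<rho>)\<close> minimises the left-hand side.\<close>
lemma talagrand_scalar: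
  fixes \<rho> :: real
  assumes "0 < \<rho>" "\<rho> \<le> 1"
  obtains \<theta> where "0 \<le> \<theta>" "\<theta> \<le> 1" "- \<theta> * ln \<rho> + (1 - \<theta>)\<^sup>2 / 4 \<le> ln (2 - \<rho>)"
proof (cases "ln \<rho> \<ge> - (1 / 2)")
  case True
  define l where "l = - ln \<rho>"
  have l: "0 \<le> l" "l \<le> 1 / 2" "exp (- l) = \<rho>"
    using True assms by (auto simp: l_def)
  have "exp (l - l\<^sup>2) \<le> 2 - \<rho>"
    using exp_sub_square_add_exp_neg_le[OF l(1)] l by simp
  then have "l - l\<^sup>2 \<le> ln (2 - \<rho>)"
    using assms by (simp add: ln_ge_iff)
  then show ?thesis
    using l by (intro that[of "1 - 2 * l"]) (auto simp: l_def power2_eq_square algebra_simps)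
next
  case False
  then have "\<rho> \<le> exp (- (1 / 2))"
    using assms by (metis exp_ln exp_le_cancel_iff linorder_le_cases)
  then have "exp (1 / 4) \<le> 2 - \<rho>"
    using exp_quarter_le exp_neg_half_le by linarith
  then have "1 / 4 \<le> ln (2 - \<rho>)"
    using assms by (subst ln_ge_iff) auto
  then show ?thesis
    by (intro that[of 0]) auto
qed

section \<open>Integrating out one coordinate at a time\<close>

text \<open>
  \<open>convex_dist_sq K A\<close> need not be measurable, so Hoelder's inequality cannot be applied to its sections.
  Therefore the induction over the coordinates runs over all convex combinations of such functions
  at once; \<open>\<beta>\<close> is the exponent of the resulting bound on \<open>exp (\<phi> / 4)\<close>.
\<close>
inductive exp_bound :: "('i \<Rightarrow> 'a measure) \<Rightarrow> 'i set \<Rightarrow> (('i \<Rightarrow> 'a) \<Rightarrow> real) \<Rightarrow> real \<Rightarrow> bool"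
  for M K where
  dist: "A \<in> sets (PiM K M) \<Longrightarrow> measure (PiM K M) A > 0 \<Longrightarrow>
    exp_bound M K (convex_dist_sq K A) (- ln (measure (PiM K M) A))"
| convex: "exp_bound M K \<phi> \<beta> \<Longrightarrow> exp_bound M K \<psi> \<gamma> \<Longrightarrow> 0 \<le> \<theta> \<Longrightarrow> \<theta> \<le> 1 \<Longrightarrow>
    exp_bound M K (\<lambda>x. \<theta> * \<phi> x + (1 - \<theta>) * \<psi> x) (\<theta> * \<beta> + (1 - \<theta>) * \<gamma>)"
| shift: "exp_bound M K \<phi> \<beta> \<Longrightarrow> exp_bound M K (\<lambda>x. \<phi> x + c) (\<beta> + c / 4)"

text \<open>Base of the induction: an empty sum of squares vanishes, while \<open>- ln\<close> of a
  probability is nonnegative.\<close>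

lemma exp_bound_empty:
  fixes M :: "'i \<Rightarrow> 'a measure"
  assumes "exp_bound M {} \<phi> \<beta>"
  shows "\<phi> x / 4 \<le> \<beta>"
  using assms
proof induction
  case (dist A)
  interpret PK: prob_space "PiM {} M" by (rule prob_space_PiM) auto
  have "A \<noteq> {}" using dist by auto
  then have "Collect (disagreement x A) \<noteq> {}" by (auto intro: point)
  then have "convex_dist_sq {} A x = 0"
    by (simp add: convex_dist_sq_def)
  then show ?case
    using dist by simp
next
  case (convex \<phi> \<beta> \<psi> \<gamma> \<theta>)
  then have "\<theta> * (\<phi> x / 4) + (1 - \<theta>) * (\<psi> x / 4) \<le> \<theta> * \<beta> + (1 - \<theta>) * \<gamma>"
    by (intro add_mono mult_left_mono) auto
  then show ?case
    by (simp add: field_simps)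
next
  case (shift \<phi> \<beta> c)
  then show ?case by (simp add: field_simps)
qed

lemma exp_convex_comb_le:
  fixes a b \<theta> :: real
  assumes "0 \<le> \<theta>" "\<theta> \<le> 1"
  shows "exp (\<theta> * a + (1 - \<theta>) * b) \<le> \<theta> * exp a + (1 - \<theta>) * exp b"
  using convex_onD[OF exp_convex, of "1 - \<theta>" a b] assms by simp

context product_prob_space
begin

lemma section_measure:
  fixes k K A
  assumes "finite K" "k \<notin> K" and A: "A \<in> sets (PiM (insert k K) M)"
  defines "sec \<equiv> \<lambda>\<omega>. {x \<in> space (PiM K M). x(k := \<omega>) \<in> A}"
  shows "\<omega> \<in> space (M k) \<Longrightarrow> sec \<omega> \<in> sets (PiM K M)"
    and "(\<lambda>\<omega>. measure (PiM K M) (sec \<omega>)) \<in> borel_measurable (M k)"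
    and "(\<integral>\<omega>. measure (PiM K M) (sec \<omega>) \<partial>M k) = measure (PiM (insert k K) M) A"
proof -
  interpret PK: prob_space "PiM K M" by (rule prob_space_PiM) (rule prob_space)
  interpret PkK: prob_space "PiM (insert k K) M" by (rule prob_space_PiM) (rule prob_space)
  note A[measurable]
  show sec: "sec \<omega> \<in> sets (PiM K M)" if [measurable]: "\<omega> \<in> space (M k)" for \<omega>
    unfolding sec_def by measurable
  have eq: "(\<integral>\<^sup>+x. indicator A (x(k := \<omega>)) \<partial>PiM K M) = ennreal (measure (PiM K M) (sec \<omega>))"
    if "\<omega> \<in> space (M k)" for \<omega>
  proof -
    have "(\<integral>\<^sup>+x. indicator A (x(k := \<omega>)) \<partial>PiM K M) = (\<integral>\<^sup>+x. indicator (sec \<omega>) x \<partial>PiM K M)"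
      by (intro nn_integral_cong) (auto simp: sec_def indicator_def)
    then show ?thesis
      using sec[OF that] by (simp add: PK.emeasure_eq_measure)
  qed
  have "(\<lambda>\<omega>. \<integral>\<^sup>+x. indicator A (x(k := \<omega>)) \<partial>PiM K M) \<in> borel_measurable (M k)"
    by measurable
  then have "(\<lambda>\<omega>. ennreal (measure (PiM K M) (sec \<omega>))) \<in> borel_measurable (M k)"
    by (subst measurable_cong[OF eq[symmetric]])
  then show m: "(\<lambda>\<omega>. measure (PiM K M) (sec \<omega>)) \<in> borel_measurable (M k)"
    by (simp add: borel_measurable_ennreal_iff)
  have "ennreal (measure (PiM (insert k K) M) A) = (\<integral>\<^sup>+x. indicator A x \<partial>PiM (insert k K) M)"
    by (simp add: PkK.emeasure_eq_measure)
  also have "\<dots> = (\<integral>\<^sup>+\<omega>. ennreal (measure (PiM K M) (sec \<omega>)) \<partial>M k)"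
    using assms(1,2) by (subst product_nn_integral_insert_rev) (auto intro!: nn_integral_cong eq)
  finally show "(\<integral>\<omega>. measure (PiM K M) (sec \<omega>) \<partial>M k) = measure (PiM (insert k K) M) A"
    using m by (subst integral_eq_nn_integral) (auto dest: arg_cong[where f = enn2real])
qed

text \<open>The step for one coordinate. Each section of \<open>\<phi>\<close> is dominated by a
  function of the same class over \<open>K\<close>, and its exponent is controlled by a measurable
  \<open>h\<close>; hence only \<open>exp h\<close> has to be integrated over coordinate
  \<open>k\<close>. The slack \<open>\<delta>\<close> is there because the supremum of the section
  measures need not be attained.\<close>

lemma exp_bound_section:
  assumes K: "finite K" "k \<notin> K" and "exp_bound M (insert k K) \<phi> \<beta>"
  shows "\<exists>h \<in> borel_measurable (M k). (\<integral>\<^sup>+\<omega>. ennreal (exp (h \<omega>)) \<partial>M k) \<le> ennreal (exp \<beta>) \<and>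
    (\<forall>\<omega>\<in>space (M k). \<forall>\<delta>>0. \<exists>\<psi> \<gamma>. exp_bound M K \<psi> \<gamma> \<and> (\<forall>x. \<phi> (x(k := \<omega>)) \<le> \<psi> x) \<and> \<gamma> \<le> h \<omega> + \<delta>)"
  using assms(3)
proof induction
  case (dist A)
  interpret PK: prob_space "PiM K M" by (rule prob_space_PiM) (rule prob_space)
  define sec where "sec = (\<lambda>\<omega>. {x \<in> space (PiM K M). x(k := \<omega>) \<in> A})"
  define p where "p \<omega> = measure (PiM K M) (sec \<omega>)" for \<omega>
  define a where "a = measure (PiM (insert k K) M) A"
  have sec: "sec \<omega> \<in> sets (PiM K M)" if "\<omega> \<in> space (M k)" for \<omega>
    using section_measure(1)[OF K dist(1) that] by (simp add: sec_def)
  have [measurable]: "p \<in> borel_measurable (M k)"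
    using section_measure(2)[OF K dist(1)] by (simp add: sec_def p_def[abs_def])
  have int_p: "(\<integral>\<omega>. p \<omega> \<partial>M k) = a"
    using section_measure(3)[OF K dist(1)] by (simp add: sec_def p_def[abs_def] a_def)
  have p01: "0 \<le> p \<omega>" "p \<omega> \<le> 1" for \<omega> by (auto simp: p_def)
  have [simp]: "integrable (M k) p"
    by (rule M.integrable_const_bound[of _ 1]) (use p01 in auto)
  have "a > 0" using dist by (simp add: a_def)
  \<comment> \<open>The supremum of the section measures; a section nearly attaining it serves as
    the second section in the recursion for every \<open>\<omega>\<close>.\<close>
  define v where "v = (SUP \<omega>\<in>space (M k). p \<omega>)"
  have bdd: "bdd_above (p ` space (M k))" using p01 by (auto intro!: bdd_aboveI)
  have p_le: "p \<omega> \<le> v" if "\<omega> \<in> space (M k)" for \<omega>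
    unfolding v_def using that by (rule cSUP_upper[OF _ bdd])
  have "a \<le> v"
  proof -
    have "a \<le> (\<integral>\<omega>. v \<partial>M k)"
      unfolding int_p[symmetric] by (rule integral_mono) (auto intro: p_le)
    then show ?thesis by (simp add: M.prob_space)
  qed
  with \<open>a > 0\<close> have "v > 0" by simp
  \<comment> \<open>\<open>talagrand_scalar\<close> with \<open>\<rho> = p \<omega> / v\<close>
    bounds the exponent of the mixture by \<open>ln (2 - \<rho>) - ln v\<close>, which is
    \<open>ln (u \<omega>)\<close>. Since \<open>u\<close> is affine in \<open>p\<close>, its
    integral depends on \<open>a\<close> and \<open>v\<close> only.\<close>
  define u where "u \<omega> = (2 - p \<omega> / v) / v" for \<omega>
  have pv: "p \<omega> / v \<le> 1" if "\<omega> \<in> space (M k)" for \<omega>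
    using p_le[OF that] \<open>v > 0\<close> by simp
  have u_pos: "u \<omega> > 0" if "\<omega> \<in> space (M k)" for \<omega>
    unfolding u_def using pv[OF that] \<open>v > 0\<close> by (intro divide_pos_pos) linarith+
  have int_u: "(\<integral>\<^sup>+\<omega>. ennreal (exp (ln (u \<omega>))) \<partial>M k) \<le> ennreal (exp (- ln a))"
  proof -
    have "(\<integral>\<^sup>+\<omega>. ennreal (exp (ln (u \<omega>))) \<partial>M k) = (\<integral>\<^sup>+\<omega>. ennreal (u \<omega>) \<partial>M k)"
      using u_pos by (intro nn_integral_cong) simp
    also have "\<dots> = ennreal (\<integral>\<omega>. u \<omega> \<partial>M k)"
      using u_pos by (intro nn_integral_eq_integral AE_I2 less_imp_le)
        (auto simp: u_def intro!: Bochner_Integration.integrable_diff)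
    also have "(\<integral>\<omega>. u \<omega> \<partial>M k) = (2 - a / v) / v"
      using int_p by (simp add: u_def M.prob_space)
    also have "\<dots> \<le> 1 / a"
    proof -
      have "0 \<le> (v - a)\<^sup>2" by simp
      then have "a * (2 * v - a) \<le> v * v" by (simp add: power2_eq_square algebra_simps)
      then show ?thesis
        using \<open>v > 0\<close> \<open>a > 0\<close> by (simp add: field_simps)
    qed
    also have "1 / a = exp (- ln a)"
      using \<open>a > 0\<close> by (simp add: exp_minus field_simps)
    finally show ?thesis by (simp add: ennreal_leI)
  qed
  have step: "\<exists>\<psi> \<gamma>. exp_bound M K \<psi> \<gamma> \<and> (\<forall>x. convex_dist_sq (insert k K) A (x(k := \<omega>)) \<le> \<psi> x) \<and>
      \<gamma> \<le> ln (u \<omega>) + \<delta>"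
    if \<omega>: "\<omega> \<in> space (M k)" and \<delta>: "\<delta> > 0" for \<omega> \<delta>
  proof -
    \<comment> \<open>Missing the supremum by a factor \<open>exp (- \<delta>)\<close> costs
      \<open>\<delta>\<close> in the exponent.\<close>
    have "v * exp (- \<delta>) < v" using \<open>v > 0\<close> \<delta> by simp
    then obtain \<omega>' where \<omega>': "\<omega>' \<in> space (M k)" "v * exp (- \<delta>) < p \<omega>'"
      unfolding v_def using less_cSUP_iff[OF M.not_empty bdd] by auto
    have p': "p \<omega>' > 0" using \<omega>'(2) \<open>v > 0\<close> by (meson exp_gt_zero less_trans mult_pos_pos)
    have "ln (v * exp (- \<delta>)) \<le> ln (p \<omega>')"
      using \<omega>' p' \<open>v > 0\<close> by (subst ln_le_cancel_iff) auto
    then have ln_p': "- ln (p \<omega>') \<le> - ln v + \<delta>"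
      using \<open>v > 0\<close> by (simp add: ln_mult)
    have ne': "sec \<omega>' \<noteq> {}" using p' by (auto simp: p_def)
    have ln_u: "ln (u \<omega>) = ln (2 - p \<omega> / v) - ln v"
    proof -
      have "2 - p \<omega> / v \<noteq> 0" "v \<noteq> 0" using pv[OF \<omega>] \<open>v > 0\<close> by linarith+
      then show ?thesis by (simp only: u_def ln_div) simp
    qed
    have base': "exp_bound M K (convex_dist_sq K (sec \<omega>')) (- ln (p \<omega>'))"
      using exp_bound.dist[OF sec[OF \<omega>'(1)]] p' by (simp add: p_def)
    show ?thesis
    proof (cases "p \<omega> > 0")
      \<comment> \<open>The own section is null, so all weight goes to the section over
        \<open>\<omega>'\<close>. The entry at \<open>k\<close> then costs 1/4, which is covered by
        \<open>ln 2\<close>.\<close>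
      case False
      with p01(1)[of \<omega>] have "p \<omega> = 0" by simp
      have "1 / 4 \<le> ln (2 :: real)"
        using exp_quarter_le by (subst ln_ge_iff) auto
      then have "- ln (p \<omega>') + 1 / 4 \<le> ln (u \<omega>) + \<delta>"
        using ln_p' ln_u \<open>p \<omega> = 0\<close> by simp
      moreover have "convex_dist_sq (insert k K) A (x(k := \<omega>)) \<le> convex_dist_sq K (sec \<omega>') x + 1" for x
        using convex_dist_sq_insert_le'[OF K, of "space (PiM K M)" \<omega>' A x \<omega>] ne' by (simp only: sec_def not_False_eq_True)
      ultimately show ?thesis
        using exp_bound.shift[OF base', of 1] by blast
    next
      case True
      have ne: "sec \<omega> \<noteq> {}" using True by (auto simp: p_def)
      have base: "exp_bound M K (convex_dist_sq K (sec \<omega>)) (- ln (p \<omega>))"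
        using exp_bound.dist[OF sec[OF \<omega>]] True by (simp add: p_def)
      obtain \<theta> where \<theta>: "0 \<le> \<theta>" "\<theta> \<le> 1" "- \<theta> * ln (p \<omega> / v) + (1 - \<theta>)\<^sup>2 / 4 \<le> ln (2 - p \<omega> / v)"
        using talagrand_scalar[of "p \<omega> / v"] True \<open>v > 0\<close> pv[OF \<omega>] by auto
      have "\<theta> * - ln (p \<omega>) + (1 - \<theta>) * - ln (p \<omega>') + (1 - \<theta>)\<^sup>2 / 4 \<le>
          \<theta> * - ln (p \<omega>) + (1 - \<theta>) * (- ln v + \<delta>) + (1 - \<theta>)\<^sup>2 / 4"
        using ln_p' \<theta> by (intro add_mono mult_left_mono) auto
      also have "\<dots> = - \<theta> * ln (p \<omega> / v) + (1 - \<theta>)\<^sup>2 / 4 - ln v + (1 - \<theta>) * \<delta>"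
        using True \<open>v > 0\<close> by (simp add: ln_div algebra_simps)
      also have "\<dots> \<le> ln (u \<omega>) + \<delta>"
      proof -
        have "(1 - \<theta>) * \<delta> \<le> \<delta>" using \<theta> \<delta> by (simp add: mult_left_le_one_le)
        then show ?thesis using \<theta>(3) ln_u by linarith
      qed
      finally have "\<theta> * - ln (p \<omega>) + (1 - \<theta>) * - ln (p \<omega>') + (1 - \<theta>)\<^sup>2 / 4 \<le> ln (u \<omega>) + \<delta>" .
      moreover have "convex_dist_sq (insert k K) A (x(k := \<omega>)) \<le>
          \<theta> * convex_dist_sq K (sec \<omega>) x + (1 - \<theta>) * convex_dist_sq K (sec \<omega>') x + (1 - \<theta>)\<^sup>2" for x
        using convex_dist_sq_insert_le[OF K \<theta>(1,2), of "space (PiM K M)" \<omega> A \<omega>' x] ne ne'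
        by (simp only: sec_def not_False_eq_True)
      ultimately show ?thesis
        using exp_bound.shift[OF exp_bound.convex[OF base base' \<theta>(1,2)], of "(1 - \<theta>)\<^sup>2"] by blast
    qed
  qed
  show ?case
  proof (rule bexI[of _ "\<lambda>\<omega>. ln (u \<omega>)"], intro conjI ballI allI impI)
    show "(\<lambda>\<omega>. ln (u \<omega>)) \<in> borel_measurable (M k)"
      unfolding u_def by measurable
    show "(\<integral>\<^sup>+\<omega>. ennreal (exp (ln (u \<omega>))) \<partial>M k) \<le>
        ennreal (exp (- ln (measure (PiM (insert k K) M) A)))"
      using int_u by (simp add: a_def)
  qed (rule step)
next
  case (convex \<phi>1 \<beta>1 \<phi>2 \<beta>2 \<theta>)
  obtain h1 where [measurable]: "h1 \<in> borel_measurable (M k)"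
    and int1: "(\<integral>\<^sup>+\<omega>. ennreal (exp (h1 \<omega>)) \<partial>M k) \<le> ennreal (exp \<beta>1)"
    and ex1: "\<And>\<omega> \<delta>. \<omega> \<in> space (M k) \<Longrightarrow> \<delta> > 0 \<Longrightarrow>
      \<exists>\<psi> \<gamma>. exp_bound M K \<psi> \<gamma> \<and> (\<forall>x. \<phi>1 (x(k := \<omega>)) \<le> \<psi> x) \<and> \<gamma> \<le> h1 \<omega> + \<delta>"
    using convex.IH(1) by blast
  obtain h2 where [measurable]: "h2 \<in> borel_measurable (M k)"
    and int2: "(\<integral>\<^sup>+\<omega>. ennreal (exp (h2 \<omega>)) \<partial>M k) \<le> ennreal (exp \<beta>2)"
    and ex2: "\<And>\<omega> \<delta>. \<omega> \<in> space (M k) \<Longrightarrow> \<delta> > 0 \<Longrightarrow>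
      \<exists>\<psi> \<gamma>. exp_bound M K \<psi> \<gamma> \<and> (\<forall>x. \<phi>2 (x(k := \<omega>)) \<le> \<psi> x) \<and> \<gamma> \<le> h2 \<omega> + \<delta>"
    using convex.IH(2) by blast
  define h where "h \<omega> = \<theta> * h1 \<omega> + (1 - \<theta>) * h2 \<omega>" for \<omega>
  define \<beta> where "\<beta> = \<theta> * \<beta>1 + (1 - \<theta>) * \<beta>2"
  have [measurable]: "h \<in> borel_measurable (M k)" by (simp add: h_def[abs_def])
  \<comment> \<open>Each \<open>exp (h1 \<omega> - \<beta>1)\<close> and
    \<open>exp (h2 \<omega> - \<beta>2)\<close> has integral at most 1. After this normalisation
    pointwise convexity of \<open>exp\<close> gives the integral bound that Hoelder's inequality
    would give.\<close>
  define c1 where "c1 = exp \<beta> * \<theta> * exp (- \<beta>1)"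
  define c2 where "c2 = exp \<beta> * (1 - \<theta>) * exp (- \<beta>2)"
  have c: "c1 \<ge> 0" "c2 \<ge> 0" using convex.hyps by (auto simp: c1_def c2_def)
  have "exp (h \<omega>) \<le> c1 * exp (h1 \<omega>) + c2 * exp (h2 \<omega>)" for \<omega>
  proof -
    have "exp (h \<omega>) = exp \<beta> * exp (\<theta> * (h1 \<omega> - \<beta>1) + (1 - \<theta>) * (h2 \<omega> - \<beta>2))"
      by (simp add: h_def \<beta>_def algebra_simps flip: exp_add)
    also have "\<dots> \<le> exp \<beta> * (\<theta> * exp (h1 \<omega> - \<beta>1) + (1 - \<theta>) * exp (h2 \<omega> - \<beta>2))"
      using convex.hyps by (intro mult_left_mono exp_convex_comb_le) auto
    also have "\<dots> = c1 * exp (h1 \<omega>) + c2 * exp (h2 \<omega>)"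
      by (simp add: c1_def c2_def exp_diff exp_minus field_simps)
    finally show ?thesis .
  qed
  then have "(\<integral>\<^sup>+\<omega>. ennreal (exp (h \<omega>)) \<partial>M k) \<le>
      (\<integral>\<^sup>+\<omega>. ennreal c1 * ennreal (exp (h1 \<omega>)) + ennreal c2 * ennreal (exp (h2 \<omega>)) \<partial>M k)"
    using c by (intro nn_integral_mono) (simp add: ennreal_leI flip: ennreal_mult ennreal_plus)
  also have "\<dots> = ennreal c1 * (\<integral>\<^sup>+\<omega>. ennreal (exp (h1 \<omega>)) \<partial>M k) +
      ennreal c2 * (\<integral>\<^sup>+\<omega>. ennreal (exp (h2 \<omega>)) \<partial>M k)"
    by (simp add: nn_integral_add nn_integral_cmult)
  also have "\<dots> \<le> ennreal c1 * ennreal (exp \<beta>1) + ennreal c2 * ennreal (exp \<beta>2)"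
    by (intro add_mono mult_left_mono int1 int2) auto
  also have "\<dots> = ennreal (c1 * exp \<beta>1 + c2 * exp \<beta>2)"
    using c by (simp add: ennreal_mult)
  also have "c1 * exp \<beta>1 + c2 * exp \<beta>2 = exp \<beta>"
    by (simp add: c1_def c2_def exp_minus field_simps)
  finally have int: "(\<integral>\<^sup>+\<omega>. ennreal (exp (h \<omega>)) \<partial>M k) \<le> ennreal (exp \<beta>)" .
  have "\<exists>\<psi> \<gamma>. exp_bound M K \<psi> \<gamma> \<and> (\<forall>x. \<theta> * \<phi>1 (x(k := \<omega>)) + (1 - \<theta>) * \<phi>2 (x(k := \<omega>)) \<le> \<psi> x) \<and>
      \<gamma> \<le> h \<omega> + \<delta>"
    if \<omega>: "\<omega> \<in> space (M k)" and "\<delta> > 0" for \<omega> \<delta>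
  proof -
    obtain \<psi>1 \<gamma>1 where 1: "exp_bound M K \<psi>1 \<gamma>1" "\<And>x. \<phi>1 (x(k := \<omega>)) \<le> \<psi>1 x" "\<gamma>1 \<le> h1 \<omega> + \<delta>"
      using ex1[OF \<omega> \<open>\<delta> > 0\<close>] by blast
    obtain \<psi>2 \<gamma>2 where 2: "exp_bound M K \<psi>2 \<gamma>2" "\<And>x. \<phi>2 (x(k := \<omega>)) \<le> \<psi>2 x" "\<gamma>2 \<le> h2 \<omega> + \<delta>"
      using ex2[OF \<omega> \<open>\<delta> > 0\<close>] by blast
    have "\<theta> * \<gamma>1 + (1 - \<theta>) * \<gamma>2 \<le> \<theta> * (h1 \<omega> + \<delta>) + (1 - \<theta>) * (h2 \<omega> + \<delta>)"
      using 1 2 convex.hyps by (intro add_mono mult_left_mono) auto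
    also have "\<dots> = h \<omega> + \<delta>" by (simp add: h_def algebra_simps)
    finally have "\<theta> * \<gamma>1 + (1 - \<theta>) * \<gamma>2 \<le> h \<omega> + \<delta>" .
    moreover have "\<theta> * \<phi>1 (x(k := \<omega>)) + (1 - \<theta>) * \<phi>2 (x(k := \<omega>)) \<le> \<theta> * \<psi>1 x + (1 - \<theta>) * \<psi>2 x" for x
      using 1 2 convex.hyps by (intro add_mono mult_left_mono) auto
    ultimately show ?thesis
      using exp_bound.convex[OF 1(1) 2(1) convex.hyps(3,4)] by blast
  qed
  then show ?case
    using int unfolding \<beta>_def by (intro bexI[of _ h] conjI ballI allI impI)
      (auto simp del: fun_upd_apply)
next
  case (shift \<phi> \<beta> c)
  obtain h where [measurable]: "h \<in> borel_measurable (M k)"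
    and int: "(\<integral>\<^sup>+\<omega>. ennreal (exp (h \<omega>)) \<partial>M k) \<le> ennreal (exp \<beta>)"
    and ex: "\<And>\<omega> \<delta>. \<omega> \<in> space (M k) \<Longrightarrow> \<delta> > 0 \<Longrightarrow>
      \<exists>\<psi> \<gamma>. exp_bound M K \<psi> \<gamma> \<and> (\<forall>x. \<phi> (x(k := \<omega>)) \<le> \<psi> x) \<and> \<gamma> \<le> h \<omega> + \<delta>"
    using shift.IH by blast
  have "(\<integral>\<^sup>+\<omega>. ennreal (exp (h \<omega> + c / 4)) \<partial>M k) =
      ennreal (exp (c / 4)) * (\<integral>\<^sup>+\<omega>. ennreal (exp (h \<omega>)) \<partial>M k)"
    by (simp add: exp_add ennreal_mult mult.commute flip: nn_integral_cmult)
  also have "\<dots> \<le> ennreal (exp (c / 4)) * ennreal (exp \<beta>)"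
    by (intro mult_left_mono int) auto
  also have "\<dots> = ennreal (exp (\<beta> + c / 4))"
    by (simp add: exp_add mult.commute flip: ennreal_mult)
  finally have int': "(\<integral>\<^sup>+\<omega>. ennreal (exp (h \<omega> + c / 4)) \<partial>M k) \<le> ennreal (exp (\<beta> + c / 4))" .
  have "\<exists>\<psi> \<gamma>. exp_bound M K \<psi> \<gamma> \<and> (\<forall>x. \<phi> (x(k := \<omega>)) + c \<le> \<psi> x) \<and> \<gamma> \<le> h \<omega> + c / 4 + \<delta>"
    if \<omega>: "\<omega> \<in> space (M k)" "\<delta> > 0" for \<omega> \<delta>
  proof -
    obtain \<psi> \<gamma> where 1: "exp_bound M K \<psi> \<gamma>" "\<And>x. \<phi> (x(k := \<omega>)) \<le> \<psi> x" "\<gamma> \<le> h \<omega> + \<delta>"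
      using ex[OF \<omega>] by blast
    show ?thesis
      by (rule exI[of _ "\<lambda>x. \<psi> x + c"], rule exI[of _ "\<gamma> + c / 4"])
        (use 1 exp_bound.shift[OF 1(1)] in auto)
  qed
  then show ?case
    using int' by (intro bexI[of _ "\<lambda>\<omega>. h \<omega> + c / 4"] conjI ballI allI impI)
      (auto simp del: fun_upd_apply)
qed

text \<open>The integrand is a measurable minorant \<open>f\<close>, since \<open>\<phi>\<close>
  itself may fail to be measurable. It varies in the induction because the hypothesis is applied to
  its sections, with \<open>\<phi>\<close> replaced by their dominating functions.\<close>

lemma nn_integral_exp_bound:
  assumes "finite K" "exp_bound M K \<phi> \<beta>" "f \<in> borel_measurable (PiM K M)"
    and "\<And>x. x \<in> space (PiM K M) \<Longrightarrow> f x \<le> ennreal (exp (\<phi> x / 4))"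
  shows "(\<integral>\<^sup>+x. f x \<partial>PiM K M) \<le> ennreal (exp \<beta>)"
  using assms
proof (induction K arbitrary: \<phi> \<beta> f rule: finite_induct)
  case empty
  interpret PK: prob_space "PiM {} M" by (rule prob_space_PiM) auto
  have "f x \<le> ennreal (exp \<beta>)" if "x \<in> space (PiM {} M)" for x
  proof -
    have "exp (\<phi> x / 4) \<le> exp \<beta>"
      using exp_bound_empty[OF empty.prems(1)] by simp
    then show ?thesis
      using empty.prems(3)[OF that] by (meson ennreal_leI order_trans)
  qed
  then have "(\<integral>\<^sup>+x. f x \<partial>PiM {} M) \<le> (\<integral>\<^sup>+x. ennreal (exp \<beta>) \<partial>PiM {} M)"
    by (rule nn_integral_mono)
  then show ?case by (simp add: PK.emeasure_space_1)
next
  case (insert k K)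
  note [measurable] = insert.prems(2)
  obtain h where [measurable]: "h \<in> borel_measurable (M k)"
    and int: "(\<integral>\<^sup>+\<omega>. ennreal (exp (h \<omega>)) \<partial>M k) \<le> ennreal (exp \<beta>)"
    and ex: "\<And>\<omega> \<delta>. \<omega> \<in> space (M k) \<Longrightarrow> \<delta> > 0 \<Longrightarrow>
      \<exists>\<psi> \<gamma>. exp_bound M K \<psi> \<gamma> \<and> (\<forall>x. \<phi> (x(k := \<omega>)) \<le> \<psi> x) \<and> \<gamma> \<le> h \<omega> + \<delta>"
    using exp_bound_section[OF insert.hyps insert.prems(1)] by blast
  have inner: "(\<integral>\<^sup>+x. f (x(k := \<omega>)) \<partial>PiM K M) \<le> ennreal (exp (h \<omega>))" if \<omega>: "\<omega> \<in> space (M k)" for \<omega>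
  proof -
    have le: "(\<integral>\<^sup>+x. f (x(k := \<omega>)) \<partial>PiM K M) \<le> ennreal (exp (h \<omega> + \<delta>))" if "\<delta> > 0" for \<delta>
    proof -
      obtain \<psi> \<gamma> where 1: "exp_bound M K \<psi> \<gamma>" "\<And>x. \<phi> (x(k := \<omega>)) \<le> \<psi> x" "\<gamma> \<le> h \<omega> + \<delta>"
        using ex[OF \<omega> \<open>\<delta> > 0\<close>] by blast
      have "(\<integral>\<^sup>+x. f (x(k := \<omega>)) \<partial>PiM K M) \<le> ennreal (exp \<gamma>)"
      proof (rule insert.IH[OF 1(1)])
        show "(\<lambda>x. f (x(k := \<omega>))) \<in> borel_measurable (PiM K M)" using \<omega> by measurable
        fix x assume "x \<in> space (PiM K M)"
        then have "x(k := \<omega>) \<in> space (PiM (insert k K) M)"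
          using \<omega> by (auto simp: space_PiM PiE_def Pi_def extensional_def)
        then have "f (x(k := \<omega>)) \<le> ennreal (exp (\<phi> (x(k := \<omega>)) / 4))"
          by (rule insert.prems(3))
        also have "\<dots> \<le> ennreal (exp (\<psi> x / 4))"
          using 1(2)[of x] by (simp add: ennreal_leI)
        finally show "f (x(k := \<omega>)) \<le> ennreal (exp (\<psi> x / 4))" .
      qed
      also have "\<dots> \<le> ennreal (exp (h \<omega> + \<delta>))"
        using 1(3) by (simp add: ennreal_leI)
      finally show ?thesis .
    qed
    have "((\<lambda>\<delta>. ennreal (exp (h \<omega> + \<delta>))) \<longlongrightarrow> ennreal (exp (h \<omega> + 0))) (at_right 0)"
      by (intro tendsto_intros tendsto_ennrealI)
    then have lim: "((\<lambda>\<delta>. ennreal (exp (h \<omega> + \<delta>))) \<longlongrightarrow> ennreal (exp (h \<omega>))) (at_right 0)"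
      by simp
    show ?thesis
      by (rule tendsto_lowerbound[OF lim])
        (use le in \<open>auto intro!: eventually_at_right_less[THEN eventually_mono]\<close>)
  qed
  have "(\<integral>\<^sup>+x. f x \<partial>PiM (insert k K) M) = (\<integral>\<^sup>+\<omega>. (\<integral>\<^sup>+x. f (x(k := \<omega>)) \<partial>PiM K M) \<partial>M k)"
    using insert.hyps by (subst product_nn_integral_insert_rev) auto
  also have "\<dots> \<le> (\<integral>\<^sup>+\<omega>. ennreal (exp (h \<omega>)) \<partial>M k)"
    by (intro nn_integral_mono inner)
  finally show ?case using int by simp
qed

text \<open>Markov's inequality for \<open>exp\<close> of a quarter of the squared distance. A
  measurable \<open>B\<close> on which the distance is large replaces the superlevel set of the
  distance, which may not be measurable.\<close>

theorem talagrand_convex_distance: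
  assumes "finite K" and A: "A \<in> sets (PiM K M)" and B: "B \<in> sets (PiM K M)"
    and dist: "\<And>x. x \<in> B \<Longrightarrow> b \<le> convex_dist_sq K A x"
  shows "measure (PiM K M) A * measure (PiM K M) B \<le> exp (- b / 4)"
proof (cases "measure (PiM K M) A > 0")
  case True
  interpret PK: prob_space "PiM K M" by (rule prob_space_PiM) (rule prob_space)
  note [measurable] = A B
  define a where "a = measure (PiM K M) A"
  have "(\<integral>\<^sup>+x. ennreal (exp (b / 4)) * indicator B x \<partial>PiM K M) \<le> ennreal (exp (- ln a))"
    unfolding a_def
    by (rule nn_integral_exp_bound[OF assms(1) exp_bound.dist[OF A True]])
      (auto simp: indicator_def ennreal_leI dist)
  then have "ennreal (exp (b / 4) * measure (PiM K M) B) \<le> ennreal (exp (- ln a))"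
    by (simp add: nn_integral_cmult PK.emeasure_eq_measure ennreal_mult)
  then have "exp (b / 4) * measure (PiM K M) B \<le> 1 / a"
    using True by (simp add: ennreal_le_iff a_def exp_minus field_simps)
  then show ?thesis
    using True by (simp add: a_def exp_minus field_simps)
next
  case False
  then have "measure (PiM K M) A = 0"
    using measure_nonneg[of "PiM K M" A] by linarith
  then show ?thesis by simp
qed

end

section \<open>Observable random variables\<close>

text \<open>Serves to replace vanishing \<open>r\<close> or \<open>d\<close> by positive
  parameters.\<close>

lemma observable_mono:
  assumes "observable n \<Omega> \<Omega>x X r d" "r \<le> r'" "d \<le> d'"
  shows "observable n \<Omega> \<Omega>x X r' d'"
proof -
  have "certificate n \<Omega> \<Omega>x X r' d' \<omega> s I c" if "certificate n \<Omega> \<Omega>x X r d \<omega> s I c" "s > 0" for \<omega> s I c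
  proof -
    have "r * s \<le> r' * s" using assms that by (intro mult_right_mono) auto
    with that assms show ?thesis
      unfolding certificate_def by (meson order_trans)
  qed
  with assms(1) show ?thesis
    unfolding observable_def by metis
qed

text \<open>Negative weights are dealt with by putting their indices into every \<open>I'\<close>: this raises the lower
  bound on \<open>\<Sum>i. max 0 (c i) * v i\<close> by as much as it raises the bound on \<open>\<Sum>i. max 0 (c i)\<close>.\<close>
lemma certificate_convex_dist_sq_ge:
  assumes cert: "certificate n \<Omega> \<Omega>x X r d x s I c" and pos: "r > 0" "d > 0" "s > 0"
    and A: "A \<subseteq> \<Omega> - \<Omega>x" "A \<noteq> {}" "\<And>y. y \<in> A \<Longrightarrow> X y \<le> a" and "a \<le> s"
  shows "(s - a)\<^sup>2 / (r * d * s) \<le> convex_dist_sq {1..n} A x"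
proof (rule convex_dist_sq_ge[OF A(2)])
  fix v assume v: "disagreement x A v"
  have I: "I \<subseteq> {1..n}" "finite I"
    using cert by (auto simp: certificate_def intro: finite_subset)
  have sum_c: "(\<Sum>i\<in>I. c i) \<le> r * s" and c_le: "\<And>i. i \<in> I \<Longrightarrow> c i \<le> d"
    using cert by (auto simp: certificate_def)
  have low: "s - (\<Sum>i\<in>I'. c i) \<le> a"
    if "I' \<subseteq> I" "y \<in> A" "\<And>i. i \<in> I - I' \<Longrightarrow> y i = x i" for I' y
    using cert that A unfolding certificate_def by (meson in_mono order_trans)
  define N where "N = (\<Sum>i\<in>I. max 0 (- c i))"
  define w where "w i = max 0 (c i)" for i
  have "N \<ge> 0" by (simp add: N_def sum_nonneg)
  have "0 \<le> s - a" using \<open>a \<le> s\<close> by simp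
  \<comment> \<open>With \<open>I' = I\<close> no agreement is demanded, so the certificate applies
    to every point of \<open>A\<close>.\<close>
  have "s - a \<le> r * s"
    using low[of I] A(2) sum_c by force
  have lin: "s - a + N \<le> (\<Sum>i\<in>I. w i * v i)"
    using v
  proof induction
    case (point y)
    define I' where "I' = {i \<in> I. x i \<noteq> y i \<or> c i < 0}"
    have "s - (\<Sum>i\<in>I'. c i) \<le> a"
      by (rule low[OF _ point]) (auto simp: I'_def)
    also have "(\<Sum>i\<in>I'. c i) = (\<Sum>i\<in>I. of_bool (x i \<noteq> y i \<or> c i < 0) * c i)"
      using I by (intro sum.mono_neutral_cong_left) (auto simp: I'_def)
    also have "\<dots> = (\<Sum>i\<in>I. w i * of_bool (x i \<noteq> y i) - max 0 (- c i))"
      by (intro sum.cong) (auto simp: w_def max_def)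
    also have "\<dots> = (\<Sum>i\<in>I. w i * of_bool (x i \<noteq> y i)) - N"
      by (simp add: sum_subtractf N_def)
    finally show ?case by linarith
  next
    case (convex v1 v2 \<theta>)
    have "s - a + N = \<theta> * (s - a + N) + (1 - \<theta>) * (s - a + N)"
      by (simp add: algebra_simps)
    also have "\<dots> \<le> \<theta> * (\<Sum>i\<in>I. w i * v1 i) + (1 - \<theta>) * (\<Sum>i\<in>I. w i * v2 i)"
      using convex by (intro add_mono mult_left_mono) auto
    also have "\<dots> = (\<Sum>i\<in>I. w i * (\<theta> * v1 i + (1 - \<theta>) * v2 i))"
      by (simp add: sum_distrib_left sum.distrib[symmetric] algebra_simps)
    finally show ?case .
  qed
  have sum_w: "(\<Sum>i\<in>I. (w i)\<^sup>2) \<le> d * (r * s + N)"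
  proof -
    have "(\<Sum>i\<in>I. (w i)\<^sup>2) \<le> (\<Sum>i\<in>I. d * w i)"
      using c_le pos by (intro sum_mono) (auto simp: power2_eq_square w_def intro!: mult_right_mono)
    also have "\<dots> = d * (\<Sum>i\<in>I. c i + max 0 (- c i))"
      unfolding sum_distrib_left[symmetric]
      by (intro arg_cong[where f = "(*) d"] sum.cong) (auto simp: w_def)
    also have "\<dots> \<le> d * (r * s + N)"
      using sum_c pos by (intro mult_left_mono) (auto simp: sum.distrib N_def)
    finally show ?thesis .
  qed
  define Q where "Q = (\<Sum>i\<in>{1..n}. (v i)\<^sup>2)"
  have sum_v: "(\<Sum>i\<in>I. (v i)\<^sup>2) \<le> Q"
    unfolding Q_def using I by (intro sum_mono2) auto
  have "Q \<ge> 0" by (simp add: Q_def sum_nonneg)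
  have "(s - a + N)\<^sup>2 \<le> (\<Sum>i\<in>I. w i * v i)\<^sup>2"
    using lin \<open>0 \<le> s - a\<close> \<open>N \<ge> 0\<close> by (intro power_mono) auto
  also have "\<dots> \<le> (\<Sum>i\<in>I. (w i)\<^sup>2) * (\<Sum>i\<in>I. (v i)\<^sup>2)"
    by (rule Cauchy_Schwarz_ineq_sum)
  also have "\<dots> \<le> d * (r * s + N) * Q"
    using sum_w sum_v \<open>Q \<ge> 0\<close> pos \<open>N \<ge> 0\<close> by (intro mult_mono) (auto intro: sum_nonneg)
  finally have le: "(s - a + N)\<^sup>2 \<le> d * (r * s + N) * Q" .
  \<comment> \<open>Removes the surplus \<open>N\<close> from the negative weights: since
    \<open>s - a \<le> r * s\<close>, the quotient \<open>(s - a + N)\<^sup>2 / (r * s + N)\<close>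
    is smallest at \<open>N = 0\<close>.\<close>
  have "(s - a)\<^sup>2 * (r * s + N) \<le> (s - a + N)\<^sup>2 * (r * s)"
  proof -
    have "(s - a) * ((s - a) * N) \<le> (r * s) * ((s - a) * N)"
      using \<open>s - a \<le> r * s\<close> \<open>0 \<le> s - a\<close> \<open>N \<ge> 0\<close> by (intro mult_right_mono) auto
    moreover have "(s - a + N)\<^sup>2 * (r * s) - (s - a)\<^sup>2 * (r * s + N) =
        ((r * s) * ((s - a) * N) - (s - a) * ((s - a) * N)) + (r * s) * ((s - a) * N) + r * s * N\<^sup>2"
      by (simp add: power2_eq_square algebra_simps)
    moreover have "(r * s) * ((s - a) * N) \<ge> 0" "r * s * N\<^sup>2 \<ge> 0"
      using pos \<open>0 \<le> s - a\<close> \<open>N \<ge> 0\<close> by auto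
    ultimately show ?thesis by linarith
  qed
  also have "\<dots> \<le> (d * (r * s + N) * Q) * (r * s)"
    using le pos by (intro mult_right_mono) auto
  finally have "(s - a)\<^sup>2 * (r * s + N) \<le> (Q * (r * d * s)) * (r * s + N)"
    by (simp add: algebra_simps)
  then have "(s - a)\<^sup>2 \<le> Q * (r * d * s)"
    using pos \<open>N \<ge> 0\<close> by (subst (asm) mult_le_cancel_right_pos) (auto intro: add_pos_nonneg)
  then show "(s - a)\<^sup>2 / (r * d * s) \<le> (\<Sum>i\<in>{1..n}. (v i)\<^sup>2)"
    using pos by (simp add: Q_def field_simps)
qed

lemma observable_two_sets:
  assumes M: "\<And>i. i \<in> {1..n} \<Longrightarrow> prob_space (M i)"
    and [measurable]: "\<Omega>x \<in> sets (PiM {1..n} M)" "X \<in> borel_measurable (PiM {1..n} M)"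
    and obs: "observable n (space (PiM {1..n} M)) \<Omega>x X r d"
    and pos: "r > 0" "d > 0" "s > 0" and "a \<le> s"
  shows "measure (PiM {1..n} M) {\<omega> \<in> space (PiM {1..n} M) - \<Omega>x. X \<omega> \<le> a} *
      measure (PiM {1..n} M) {\<omega> \<in> space (PiM {1..n} M) - \<Omega>x. s \<le> X \<omega>} \<le>
    exp (- (s - a)\<^sup>2 / (4 * (r * d) * s))"
proof (cases "{\<omega> \<in> space (PiM {1..n} M) - \<Omega>x. X \<omega> \<le> a} = {}")
  \<comment> \<open>Over an empty set the infimum defining the distance is meaningless, but the
    product of the probabilities is 0.\<close>
  case True
  show ?thesis unfolding True by simp
next
  case False
  define M' where "M' i = (if i \<in> {1..n} then M i else return (count_space UNIV) undefined)" for i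
  have PM: "PiM {1..n} M = PiM {1..n} M'"
    by (rule PiM_cong) (auto simp: M'_def)
  have "prob_space (M' i)" for i
    using M by (auto simp: M'_def intro: prob_space_return)
  then interpret product_prob_space M' "{1..n}"
    by (simp add: product_prob_space_def product_prob_space_axioms_def product_sigma_finite_def
        prob_space_imp_sigma_finite)
  let ?A = "{\<omega> \<in> space (PiM {1..n} M) - \<Omega>x. X \<omega> \<le> a}"
  let ?B = "{\<omega> \<in> space (PiM {1..n} M) - \<Omega>x. s \<le> X \<omega>}"
  have "?A \<in> sets (PiM {1..n} M)" "?B \<in> sets (PiM {1..n} M)"
    by measurable
  moreover have "(s - a)\<^sup>2 / (r * d * s) \<le> convex_dist_sq {1..n} ?A x" if x: "x \<in> ?B" for x
  proof -
    obtain I c where "certificate n (space (PiM {1..n} M)) \<Omega>x X r d x s I c"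
      using obs x pos unfolding observable_def by blast
    then show ?thesis
      by (rule certificate_convex_dist_sq_ge[OF _ pos]) (use False \<open>a \<le> s\<close> in auto)
  qed
  ultimately have "measure (PiM {1..n} M) ?A * measure (PiM {1..n} M) ?B \<le>
      exp (- ((s - a)\<^sup>2 / (r * d * s)) / 4)"
    using talagrand_convex_distance[of "{1..n}" ?A ?B] unfolding PM by blast
  then show ?thesis by (simp add: mult_ac)
qed

section \<open>Concentration around median and mean\<close>

context prob_space
begin

text \<open>The median is the least point where the distribution function reaches 1/2: right
  continuity gives the first bound, the left limit the second.\<close>

lemma exists_median:
  fixes X :: "'a \<Rightarrow> real"
  assumes [measurable]: "random_variable borel X"
  obtains m where "prob {\<omega> \<in> space M. X \<omega> \<le> m} \<ge> 1 / 2" "prob {\<omega> \<in> space M. m \<le> X \<omega>} \<ge> 1 / 2"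
proof -
  define D where "D = distr M borel X"
  interpret D: real_distribution D
    unfolding D_def by (intro real_distribution_distr) auto
  define A where "A = {x. cdf D x \<ge> 1 / 2}"
  have "eventually (\<lambda>x. cdf D x > 1 / 2) at_top"
    using D.cdf_lim_at_top_prob by (rule order_tendstoD) simp
  then obtain x0 where "cdf D x0 > 1 / 2"
    by (metis eventually_at_top_linorder order_refl)
  then have "A \<noteq> {}" by (auto simp: A_def intro: less_imp_le)
  have "eventually (\<lambda>x. cdf D x < 1 / 2) at_bot"
    using D.cdf_lim_at_bot by (rule order_tendstoD) simp
  then obtain y0 where y0: "\<And>y. y \<le> y0 \<Longrightarrow> cdf D y < 1 / 2"
    by (metis eventually_at_bot_linorder)
  then have bdd: "bdd_below A"
    by (intro bdd_belowI[of _ y0]) (metis A_def linorder_le_cases mem_Collect_eq not_le)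
  define m where "m = Inf A"
  have "cdf D m \<ge> 1 / 2"
  proof (rule tendsto_lowerbound)
    show "(cdf D \<longlongrightarrow> cdf D m) (at_right m)"
      using D.cdf_is_right_cont by (simp add: continuous_within)
    have "cdf D x \<ge> 1 / 2" if "x > m" for x
    proof -
      obtain y where "y \<in> A" "y < x"
        using cInf_lessD[OF \<open>A \<noteq> {}\<close>] \<open>x > m\<close> unfolding m_def by metis
      then show ?thesis
        using D.cdf_nondecreasing[of y x] by (auto simp: A_def)
    qed
    then show "eventually (\<lambda>x. 1 / 2 \<le> cdf D x) (at_right m)"
      by (rule eventually_at_right_less[THEN eventually_mono])
  qed simp
  have "measure D {..<m} \<le> 1 / 2"
  proof (rule tendsto_upperbound)
    show "(cdf D \<longlongrightarrow> measure D {..<m}) (at_left m)"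
      by (rule D.cdf_at_left)
    have "cdf D x \<le> 1 / 2" if "x < m" for x
      using that cInf_lower[OF _ bdd, of x] by (force simp: A_def m_def)
    then show "eventually (\<lambda>x. cdf D x \<le> 1 / 2) (at_left m)"
      by (auto simp: eventually_at_left_field intro: exI[of _ "m - 1"])
  qed simp
  have "prob {\<omega> \<in> space M. X \<omega> \<le> m} = cdf D m"
    by (auto simp: cdf_def D_def measure_distr vimage_def intro!: arg_cong[where f = prob])
  moreover have "prob {\<omega> \<in> space M. X \<omega> < m} = measure D {..<m}"
    by (auto simp: D_def measure_distr vimage_def intro!: arg_cong[where f = prob])
  moreover have "prob {\<omega> \<in> space M. m \<le> X \<omega>} = 1 - prob {\<omega> \<in> space M. X \<omega> < m}"
    by (subst prob_compl[symmetric]) (auto intro!: arg_cong[where f = prob])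
  ultimately show ?thesis
    using \<open>cdf D m \<ge> 1 / 2\<close> \<open>measure D {..<m} \<le> 1 / 2\<close> by (intro that[of m]) auto
qed

text \<open>The median is the lower threshold for the upper tail and the upper threshold for the
  lower tail. Its side keeps probability at least 1/4 outside \<open>\<Omega>x\<close>, so each tail
  contributes a factor 4.\<close>

lemma median_tail:
  fixes X :: "'a \<Rightarrow> real" and \<kappa> m u :: real
  assumes [measurable]: "random_variable borel X" "\<Omega>x \<in> events"
    and X: "\<And>\<omega>. \<omega> \<in> space M \<Longrightarrow> X \<omega> \<ge> 0" and \<kappa>: "\<kappa> > 0"
    and two_sets: "\<And>a s. s > 0 \<Longrightarrow> a \<le> s \<Longrightarrow>
      prob {\<omega> \<in> space M - \<Omega>x. X \<omega> \<le> a} * prob {\<omega> \<in> space M - \<Omega>x. s \<le> X \<omega>} \<le>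
      exp (- (s - a)\<^sup>2 / (4 * \<kappa> * s))"
    and med: "prob {\<omega> \<in> space M. X \<omega> \<le> m} \<ge> 1 / 2" "prob {\<omega> \<in> space M. m \<le> X \<omega>} \<ge> 1 / 2"
    and p: "prob \<Omega>x \<le> 1 / 4" and "m \<ge> 0" "u > 0"
  shows "prob {\<omega> \<in> space M - \<Omega>x. u \<le> \<bar>X \<omega> - m\<bar>} \<le> 8 * exp (- u\<^sup>2 / (4 * \<kappa> * (m + u)))"
proof -
  let ?e = "exp (- u\<^sup>2 / (4 * \<kappa> * (m + u)))"
  have quarter: "prob (A - \<Omega>x) \<ge> 1 / 4" if "A \<in> events" "prob A \<ge> 1 / 2" for A
  proof -
    have "prob A \<le> prob ((A - \<Omega>x) \<union> \<Omega>x)"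
      using that by (intro finite_measure_mono) auto
    also have "\<dots> \<le> prob (A - \<Omega>x) + prob \<Omega>x"
      using that by (intro measure_Un_le) auto
    finally show ?thesis using p that by linarith
  qed
  have set_eq: "{\<omega> \<in> space M. Q \<omega>} - \<Omega>x = {\<omega> \<in> space M - \<Omega>x. Q \<omega>}" for Q
    by auto
  have upper: "prob {\<omega> \<in> space M - \<Omega>x. m + u \<le> X \<omega>} \<le> 4 * ?e"
  proof -
    have "1 / 4 * prob {\<omega> \<in> space M - \<Omega>x. m + u \<le> X \<omega>} \<le>
        prob {\<omega> \<in> space M - \<Omega>x. X \<omega> \<le> m} * prob {\<omega> \<in> space M - \<Omega>x. m + u \<le> X \<omega>}"
      using quarter[OF _ med(1)] by (intro mult_right_mono) (auto simp: set_eq)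
    also have "\<dots> \<le> exp (- ((m + u) - m)\<^sup>2 / (4 * \<kappa> * (m + u)))"
      using \<open>m \<ge> 0\<close> \<open>u > 0\<close> by (intro two_sets) auto
    finally show ?thesis by simp
  qed
  have lower: "prob {\<omega> \<in> space M - \<Omega>x. X \<omega> \<le> m - u} \<le> 4 * ?e"
  \<comment> \<open>\<open>two_sets\<close> requires a positive upper threshold; for
    \<open>m = 0\<close> the lower tail is empty because \<open>X\<close> is nonnegative.\<close>
  proof (cases "m = 0")
    case True
    then have "{\<omega> \<in> space M - \<Omega>x. X \<omega> \<le> m - u} = {}"
      using X \<open>u > 0\<close> by force
    then show ?thesis by (simp only: measure_empty) simp
  next
    case False
    with \<open>m \<ge> 0\<close> have "m > 0" by simp
    have "prob {\<omega> \<in> space M - \<Omega>x. X \<omega> \<le> m - u} * (1 / 4) \<le>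
        prob {\<omega> \<in> space M - \<Omega>x. X \<omega> \<le> m - u} * prob {\<omega> \<in> space M - \<Omega>x. m \<le> X \<omega>}"
      using quarter[OF _ med(2)] by (intro mult_left_mono) (auto simp: set_eq)
    also have "\<dots> \<le> exp (- (m - (m - u))\<^sup>2 / (4 * \<kappa> * m))"
      using \<open>m > 0\<close> \<open>u > 0\<close> by (intro two_sets) auto
    also have "\<dots> \<le> ?e"
      using \<open>m > 0\<close> \<open>u > 0\<close> \<kappa> by (simp add: divide_left_mono)
    finally show ?thesis by simp
  qed
  have "prob {\<omega> \<in> space M - \<Omega>x. u \<le> \<bar>X \<omega> - m\<bar>} \<le>
      prob ({\<omega> \<in> space M - \<Omega>x. m + u \<le> X \<omega>} \<union> {\<omega> \<in> space M - \<Omega>x. X \<omega> \<le> m - u})"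
    by (intro finite_measure_mono) auto
  also have "\<dots> \<le> prob {\<omega> \<in> space M - \<Omega>x. m + u \<le> X \<omega>} + prob {\<omega> \<in> space M - \<Omega>x. X \<omega> \<le> m - u}"
    by (intro measure_Un_le) auto
  finally show ?thesis using upper lower by simp
qed

text \<open>The integral of the tail is replaced by a sum over the multiples of \<open>v\<close>; a step \<open>v\<close> with
  \<open>v\<^sup>2 \<ge> 16 * \<kappa> * (m + v)\<close> makes the sum geometric.\<close>
lemma expectation_near_median:
  fixes X :: "'a \<Rightarrow> real" and \<kappa> m S :: real
  assumes [measurable]: "random_variable borel X" "\<Omega>x \<in> events"
    and X: "\<And>\<omega>. \<omega> \<in> space M \<Longrightarrow> X \<omega> \<ge> 0" and \<kappa>: "\<kappa> > 0" and "m \<ge> 0"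
    and tail: "\<And>u. u > 0 \<Longrightarrow> prob {\<omega> \<in> space M - \<Omega>x. u \<le> \<bar>X \<omega> - m\<bar>} \<le>
      8 * exp (- u\<^sup>2 / (4 * \<kappa> * (m + u)))"
    and bounded: "prob \<Omega>x = 0 \<or> m \<le> S \<and> (\<forall>\<omega>\<in>space M. X \<omega> \<le> S)" and "S \<ge> 0"
  shows "integrable M X"
    and "\<bar>expectation X - m\<bar> \<le> prob \<Omega>x * S + 2 * (4 * sqrt (\<kappa> * m) + 16 * \<kappa>)"
proof -
  \<comment> \<open>An upper estimate for the positive root of
    \<open>v\<^sup>2 = 16 * \<kappa> * (m + v)\<close>.\<close>
  define v where "v = 4 * sqrt (\<kappa> * m) + 16 * \<kappa>"
  have "sqrt (\<kappa> * m) \<ge> 0" using \<kappa> \<open>m \<ge> 0\<close> by simp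
  then have "v > 0" using \<kappa> by (simp add: v_def add_nonneg_pos)
  have v_sq: "16 * \<kappa> * (m + v) \<le> v\<^sup>2"
  proof -
    have "v\<^sup>2 - 16 * \<kappa> * v = 16 * (sqrt (\<kappa> * m))\<^sup>2 + 64 * \<kappa> * sqrt (\<kappa> * m)"
      by (simp add: v_def power2_eq_square algebra_simps)
    moreover have "(sqrt (\<kappa> * m))\<^sup>2 = \<kappa> * m" using \<kappa> \<open>m \<ge> 0\<close> by simp
    moreover have "64 * \<kappa> * sqrt (\<kappa> * m) \<ge> 0" using \<kappa> \<open>m \<ge> 0\<close> by simp
    ultimately show ?thesis by (simp add: algebra_simps)
  qed
  \<comment> \<open>Counting starts at \<open>v\<close>, so the deviation is at most
    \<open>v\<close> times one plus the number of \<open>T k\<close> that contain the point.\<close>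
  define T where "T k = {\<omega> \<in> space M - \<Omega>x. real (Suc k) * v \<le> \<bar>X \<omega> - m\<bar>}" for k :: nat
  have [measurable]: "T k \<in> events" for k
    unfolding T_def by measurable
  have prob_T: "prob (T k) \<le> 8 * (1 / 16) ^ Suc k" for k
  proof -
    define j where "j = real (Suc k)"
    have "j \<ge> 1" by (simp add: j_def)
    have "4 * j * (4 * \<kappa> * (m + j * v)) \<le> j * (16 * \<kappa> * (j * m + j * v))"
      using \<open>j \<ge> 1\<close> \<kappa> \<open>m \<ge> 0\<close> mult_right_mono[of 1 j m] by simp
    also have "\<dots> = j\<^sup>2 * (16 * \<kappa> * (m + v))"
      by (simp add: power2_eq_square algebra_simps)
    also have "\<dots> \<le> j\<^sup>2 * v\<^sup>2"
      by (intro mult_left_mono v_sq) simp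
    finally have "4 * j \<le> (j * v)\<^sup>2 / (4 * \<kappa> * (m + j * v))"
      using \<kappa> \<open>m \<ge> 0\<close> \<open>v > 0\<close> \<open>j \<ge> 1\<close>
      by (subst pos_le_divide_eq) (auto simp: power_mult_distrib intro!: mult_pos_pos add_nonneg_pos)
    then have "exp (- (j * v)\<^sup>2 / (4 * \<kappa> * (m + j * v))) \<le> exp (- (4 * j))"
      by simp
    also have "\<dots> = exp (- 4) ^ Suc k"
      by (simp add: j_def exp_of_nat_mult[symmetric] mult.commute del: of_nat_Suc power_Suc)
    also have "\<dots> \<le> (1 / 16) ^ Suc k"
    proof (intro power_mono)
      have "(2 :: real) ^ 4 \<le> exp 1 ^ 4"
        using exp_ge_add_one_self[of 1] by (intro power_mono) auto
      also have "exp 1 ^ 4 = (exp 4 :: real)"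
        by (simp flip: exp_of_nat_mult)
      finally show "exp (- 4 :: real) \<le> 1 / 16"
        by (simp add: exp_minus field_simps)
    qed simp
    finally show ?thesis
      using tail[of "j * v"] \<open>v > 0\<close> \<open>j \<ge> 1\<close> by (simp add: T_def j_def)
  qed
  have "AE \<omega> in M. prob \<Omega>x = 0 \<longrightarrow> \<omega> \<notin> \<Omega>x"
    by (cases "prob \<Omega>x = 0") (auto simp: prob_eq_0)
  \<comment> \<open>On \<open>\<Omega>x\<close> both \<open>X\<close> and \<open>m\<close> lie
    between 0 and \<open>S\<close>, unless \<open>\<Omega>x\<close> is null; then \<open>S\<close>
    carries no information and \<open>\<Omega>x\<close> is discarded.\<close>
  then have AE: "AE \<omega> in M. ennreal \<bar>X \<omega> - m\<bar> \<le>
      ennreal S * indicator \<Omega>x \<omega> + ennreal v * (1 + (\<Sum>k. indicator (T k) \<omega>))"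
  proof (rule AE_mp, intro AE_I2 impI)
    fix \<omega> assume \<omega>: "\<omega> \<in> space M" and null: "prob \<Omega>x = 0 \<longrightarrow> \<omega> \<notin> \<Omega>x"
    show "ennreal \<bar>X \<omega> - m\<bar> \<le> ennreal S * indicator \<Omega>x \<omega> + ennreal v * (1 + (\<Sum>k. indicator (T k) \<omega>))"
    proof (cases "\<omega> \<in> \<Omega>x")
      case True
      with null bounded \<omega> X[OF \<omega>] \<open>m \<ge> 0\<close> have "\<bar>X \<omega> - m\<bar> \<le> S" by force
      then have "ennreal \<bar>X \<omega> - m\<bar> \<le> ennreal S * indicator \<Omega>x \<omega>"
        using True by (simp add: ennreal_leI)
      then show ?thesis by (simp add: add_increasing2)
    next
      case False
      define N where "N = nat \<lfloor>\<bar>X \<omega> - m\<bar> / v\<rfloor>"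
      have N: "real N \<le> \<bar>X \<omega> - m\<bar> / v" "\<bar>X \<omega> - m\<bar> / v \<le> real N + 1"
        using \<open>v > 0\<close> unfolding N_def by auto
      have "of_nat N = (\<Sum>k<N. indicator (T k) \<omega> :: ennreal)"
      proof -
        have "\<omega> \<in> T k" if "k < N" for k
        proof -
          have "real (Suc k) \<le> \<bar>X \<omega> - m\<bar> / v" using N(1) that by linarith
          then show ?thesis
            using \<omega> False \<open>v > 0\<close> by (simp add: T_def field_simps)
        qed
        then show ?thesis by simp
      qed
      also have "\<dots> \<le> (\<Sum>k. indicator (T k) \<omega>)"
        by (intro sum_le_suminf) auto
      finally have "1 + of_nat N \<le> 1 + (\<Sum>k. indicator (T k) \<omega> :: ennreal)"
        by (intro add_left_mono)
      then have "ennreal v * (1 + of_nat N) \<le> ennreal v * (1 + (\<Sum>k. indicator (T k) \<omega>))"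
        by (intro mult_left_mono) auto
      moreover have "ennreal \<bar>X \<omega> - m\<bar> \<le> ennreal v * (1 + of_nat N)"
      proof -
        have "\<bar>X \<omega> - m\<bar> \<le> v * (1 + real N)"
          using N(2) \<open>v > 0\<close> by (simp add: field_simps)
        then have "ennreal \<bar>X \<omega> - m\<bar> \<le> ennreal (v * (1 + real N))"
          by (rule ennreal_leI)
        also have "\<dots> = ennreal v * (1 + of_nat N)"
          using \<open>v > 0\<close> by (simp add: ennreal_mult ennreal_of_nat_eq_real_of_nat flip: ennreal_1)
        finally show ?thesis .
      qed
      ultimately show ?thesis using False by simp
    qed
  qed
  \<comment> \<open>The total 1 + 8/15 is below 2, whence the factor 2 in the conclusion.\<close>
  have sum_T: "(\<Sum>k. ennreal (prob (T k))) \<le> ennreal (8 / 15)"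
  proof -
    have "(\<Sum>k. ennreal (prob (T k))) \<le> (\<Sum>k. ennreal (8 * (1 / 16) ^ Suc k))"
      by (intro suminf_le ennreal_leI prob_T) auto
    also have "\<dots> = ennreal (8 / 15)"
    proof (rule suminf_ennreal_eq)
      show "(\<lambda>k. 8 * (1 / 16 :: real) ^ Suc k) sums (8 / 15)"
        using sums_mult[OF geometric_sums[of "1 / 16 :: real"], of "1 / 2"] by simp
    qed simp
    finally show ?thesis .
  qed
  have "(\<integral>\<^sup>+\<omega>. ennreal \<bar>X \<omega> - m\<bar> \<partial>M) \<le>
      (\<integral>\<^sup>+\<omega>. ennreal S * indicator \<Omega>x \<omega> + ennreal v * (1 + (\<Sum>k. indicator (T k) \<omega>)) \<partial>M)"
    by (rule nn_integral_mono_AE[OF AE])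
  also have "\<dots> = ennreal S * ennreal (prob \<Omega>x) + ennreal v * (1 + (\<Sum>k. ennreal (prob (T k))))"
    by (simp add: nn_integral_add nn_integral_cmult nn_integral_suminf emeasure_eq_measure prob_space)
  also have "\<dots> \<le> ennreal S * ennreal (prob \<Omega>x) + ennreal v * (1 + ennreal (8 / 15))"
    by (intro add_left_mono mult_left_mono sum_T) auto
  also have "1 + ennreal (8 / 15) = ennreal (1 + 8 / 15)"
    by (subst ennreal_plus) auto
  also have "ennreal S * ennreal (prob \<Omega>x) + ennreal v * ennreal (1 + 8 / 15) =
      ennreal (S * prob \<Omega>x + v * (1 + 8 / 15))"
    using \<open>S \<ge> 0\<close> \<open>v > 0\<close> by (simp add: ennreal_plus flip: ennreal_mult)
  also have "\<dots> \<le> ennreal (prob \<Omega>x * S + 2 * v)"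
    using \<open>v > 0\<close> by (intro ennreal_leI) (simp add: mult.commute)
  finally have nn: "(\<integral>\<^sup>+\<omega>. ennreal \<bar>X \<omega> - m\<bar> \<partial>M) \<le> ennreal (prob \<Omega>x * S + 2 * v)" .
  have int: "integrable M (\<lambda>\<omega>. X \<omega> - m)"
    using nn by (intro integrableI_bounded) (auto simp: top.not_eq_extremum intro: le_less_trans)
  then have "integrable M (\<lambda>\<omega>. X \<omega> - m + m)"
    by (intro Bochner_Integration.integrable_add) auto
  then show X_int: "integrable M X" by simp
  have "\<bar>expectation X - m\<bar> = \<bar>expectation (\<lambda>\<omega>. X \<omega> - m)\<bar>"
    using X_int by (simp add: prob_space)
  also have "\<dots> \<le> expectation (\<lambda>\<omega>. \<bar>X \<omega> - m\<bar>)"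
    by (rule integral_abs_bound)
  also have "\<dots> \<le> prob \<Omega>x * S + 2 * v"
  proof -
    have "ennreal (expectation (\<lambda>\<omega>. \<bar>X \<omega> - m\<bar>)) \<le> ennreal (prob \<Omega>x * S + 2 * v)"
      using nn int by (subst nn_integral_eq_integral[symmetric]) auto
    then show ?thesis
      using \<open>S \<ge> 0\<close> \<open>v > 0\<close> by (subst (asm) ennreal_le_iff) auto
  qed
  finally show "\<bar>expectation X - m\<bar> \<le> prob \<Omega>x * S + 2 * (4 * sqrt (\<kappa> * m) + 16 * \<kappa>)"
    by (simp add: v_def)
qed

lemma two_sets_concentration:
  fixes X :: "'a \<Rightarrow> real" and \<kappa> t S :: real
  assumes [measurable]: "random_variable borel X" "\<Omega>x \<in> events"
    and X: "\<And>\<omega>. \<omega> \<in> space M \<Longrightarrow> X \<omega> \<ge> 0" and \<kappa>: "\<kappa> > 0"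
    and two_sets: "\<And>a s. s > 0 \<Longrightarrow> a \<le> s \<Longrightarrow>
      prob {\<omega> \<in> space M - \<Omega>x. X \<omega> \<le> a} * prob {\<omega> \<in> space M - \<Omega>x. s \<le> X \<omega>} \<le>
      exp (- (s - a)\<^sup>2 / (4 * \<kappa> * s))"
    and bounded: "prob \<Omega>x = 0 \<or> (\<forall>\<omega>\<in>space M. X \<omega> \<le> S)" and "S \<ge> 0"
    and t: "t > 96 * sqrt (\<kappa> * expectation X) + 128 * \<kappa> + 8 * prob \<Omega>x * S"
  shows "prob {\<omega> \<in> space M. \<bar>X \<omega> - expectation X\<bar> > t} \<le>
    4 * exp (- t\<^sup>2 / (8 * \<kappa> * (4 * expectation X + t))) + 4 * prob \<Omega>x"
proof (cases "prob \<Omega>x \<le> 1 / 4")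
  case False
  then have "1 \<le> 4 * exp (- t\<^sup>2 / (8 * \<kappa> * (4 * expectation X + t))) + 4 * prob \<Omega>x"
    by (simp add: add_increasing)
  then show ?thesis
    using prob_le_1 order_trans by blast
next
  case p: True
  obtain m where m: "prob {\<omega> \<in> space M. X \<omega> \<le> m} \<ge> 1 / 2" "prob {\<omega> \<in> space M. m \<le> X \<omega>} \<ge> 1 / 2"
    by (rule exists_median[of X]) auto
  obtain \<omega>0 where "\<omega>0 \<in> space M" "X \<omega>0 \<le> m"
    using m(1) by (metis (mono_tags, lifting) Collect_empty_eq measure_empty
        divide_le_0_1_iff zero_less_numeral not_le)
  then have "m \<ge> 0" using X by force
  obtain \<omega>1 where \<omega>1: "\<omega>1 \<in> space M" "m \<le> X \<omega>1"
    using m(2) by (metis (mono_tags, lifting) Collect_empty_eq measure_empty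
        divide_le_0_1_iff zero_less_numeral not_le)
  define e where "e = expectation X"
  define q where "q = sqrt (\<kappa> * e)"
  define p where "p = prob \<Omega>x"
  have tail: "prob {\<omega> \<in> space M - \<Omega>x. u \<le> \<bar>X \<omega> - m\<bar>} \<le> 8 * exp (- u\<^sup>2 / (4 * \<kappa> * (m + u)))"
    if "u > 0" for u
    by (rule median_tail[OF assms(1,2) X \<kappa> two_sets m p \<open>m \<ge> 0\<close> that])
  have bounded': "prob \<Omega>x = 0 \<or> m \<le> S \<and> (\<forall>\<omega>\<in>space M. X \<omega> \<le> S)"
    using bounded \<omega>1 by force
  have int_X: "integrable M X"
    by (rule expectation_near_median(1)[OF assms(1,2) X \<kappa> \<open>m \<ge> 0\<close> tail bounded' \<open>S \<ge> 0\<close>])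
  have near: "\<bar>e - m\<bar> \<le> p * S + 2 * (4 * sqrt (\<kappa> * m) + 16 * \<kappa>)"
    unfolding e_def p_def
    by (rule expectation_near_median(2)[OF assms(1,2) X \<kappa> \<open>m \<ge> 0\<close> tail bounded' \<open>S \<ge> 0\<close>])
  have "e \<ge> 0" unfolding e_def using X by (intro Bochner_Integration.integral_nonneg_AE AE_I2)
  \<comment> \<open>Markov's inequality at the median.\<close>
  have "m \<le> 2 * e"
  proof -
    let ?B = "{\<omega> \<in> space M. m \<le> X \<omega>}"
    have [measurable]: "?B \<in> events" by measurable
    have "integrable M (\<lambda>\<omega>. m * indicator ?B \<omega>)"
      by (intro integrable_mult_right integrable_real_indicator) (auto simp: less_top[symmetric])
    then have "expectation (\<lambda>\<omega>. m * indicator ?B \<omega>) \<le> e"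
      unfolding e_def using X int_X by (intro integral_mono) (auto simp: indicator_def)
    then have "m * prob ?B \<le> e"
      by simp
    then show ?thesis
      using mult_left_mono[OF m(2) \<open>m \<ge> 0\<close>] by simp
  qed
  have "q \<ge> 0" "q\<^sup>2 = \<kappa> * e" using \<kappa> \<open>e \<ge> 0\<close> by (auto simp: q_def)
  have "p \<ge> 0" by (simp add: p_def)
  have "p * S \<ge> 0" using \<open>p \<ge> 0\<close> \<open>S \<ge> 0\<close> by simp
  have t': "t > 96 * q + 128 * \<kappa> + 8 * (p * S)"
    using t by (simp add: q_def e_def p_def)
  then have "t > 0" "t > 96 * q" "t > 128 * \<kappa>"
    using \<kappa> \<open>q \<ge> 0\<close> \<open>p * S \<ge> 0\<close> by auto
  \<comment> \<open>Here 3/2 bounds the square root of 2. The distance from mean to median becomes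
    at most \<open>p * S + 12 * q + 32 * \<kappa>\<close>, whereas \<open>t / 4\<close> exceeds
    \<open>2 * p * S + 24 * q + 32 * \<kappa>\<close>.\<close>
  have "sqrt (\<kappa> * m) \<le> 3 / 2 * q"
  proof (rule real_le_lsqrt)
    have "\<kappa> * m \<le> \<kappa> * (2 * e)" using \<kappa> \<open>m \<le> 2 * e\<close> by simp
    also have "\<dots> \<le> 9 / 4 * q\<^sup>2" using \<open>q\<^sup>2 = _\<close> \<kappa> \<open>e \<ge> 0\<close> by simp
    finally show "\<kappa> * m \<le> (3 / 2 * q)\<^sup>2" by (simp add: power2_eq_square)
  qed (use \<open>q \<ge> 0\<close> in simp)
  then have near': "\<bar>e - m\<bar> \<le> t / 4"
    using near t' \<open>q \<ge> 0\<close> \<open>p * S \<ge> 0\<close>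
    by (simp only: mult.assoc[symmetric] distrib_left)
  define u where "u = 3 * t / 4"
  define y where "y = t\<^sup>2 / (8 * \<kappa> * (4 * e + t))"
  have "u > 0" using \<open>t > 0\<close> by (simp add: u_def)
  have pos: "4 * e + t > 0" using \<open>e \<ge> 0\<close> \<open>t > 0\<close> by simp
  \<comment> \<open>Makes the surplus \<open>y / 8\<close> obtained next at least 1, which pays for
    halving the factor 8.\<close>
  have "y \<ge> 8"
  proof -
    have "128 * \<kappa> * t \<le> t * t" using \<open>t > 128 * \<kappa>\<close> \<open>t > 0\<close> by (intro mult_right_mono) auto
    moreover have "(96 * q)\<^sup>2 \<le> t\<^sup>2" using \<open>t > 96 * q\<close> \<open>q \<ge> 0\<close> by (intro power_mono) auto
    moreover have "(96 * q)\<^sup>2 = 9216 * (\<kappa> * e)" using \<open>q\<^sup>2 = _\<close> by (simp add: power_mult_distrib)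
    moreover have "\<kappa> * e \<ge> 0" using \<kappa> \<open>e \<ge> 0\<close> by simp
    ultimately have "8 * (8 * \<kappa> * (4 * e + t)) \<le> t\<^sup>2"
      unfolding power2_eq_square[of t] by (simp add: algebra_simps)
    then show ?thesis
      unfolding y_def using \<kappa> pos by (subst pos_le_divide_eq) auto
  qed
  \<comment> \<open>The square of 3/4 gives 9/16, and the denominator is at most half of the one in
    \<open>y\<close>, since \<open>m \<le> 2 * e\<close>.\<close>
  have "y * 9 / 8 \<le> u\<^sup>2 / (4 * \<kappa> * (m + u))"
  proof -
    have "4 * \<kappa> * (m + u) \<le> \<kappa> * (8 * e + 3 * t)"
      using \<kappa> \<open>m \<le> 2 * e\<close> by (simp add: u_def)
    also have "\<dots> \<le> \<kappa> * (4 * (4 * e + t))"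
      using \<kappa> \<open>e \<ge> 0\<close> \<open>t > 0\<close> by simp
    finally have "4 * \<kappa> * (m + u) \<le> \<kappa> * (4 * (4 * e + t))" .
    then have "u\<^sup>2 / (\<kappa> * (4 * (4 * e + t))) \<le> u\<^sup>2 / (4 * \<kappa> * (m + u))"
      using \<kappa> \<open>m \<ge> 0\<close> \<open>u > 0\<close> pos by (intro divide_left_mono) auto
    moreover have "u\<^sup>2 / (\<kappa> * (4 * (4 * e + t))) = y * 9 / 8"
      using \<kappa> pos by (simp add: u_def y_def power2_eq_square field_simps)
    ultimately show ?thesis by linarith
  qed
  then have "exp (- u\<^sup>2 / (4 * \<kappa> * (m + u))) \<le> exp (- y - y / 8)"
    by simp
  also have "\<dots> \<le> exp (- y - 1)"
    using \<open>y \<ge> 8\<close> by simp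
  also have "\<dots> \<le> exp (- y) / 2"
    unfolding exp_diff using exp_ge_add_one_self[of 1] by (intro divide_left_mono) auto
  finally have e1: "8 * exp (- u\<^sup>2 / (4 * \<kappa> * (m + u))) \<le> 4 * exp (- y)" by simp
  have "u \<le> \<bar>X \<omega> - m\<bar>" if "t < \<bar>X \<omega> - e\<bar>" for \<omega>
    using that near' unfolding u_def by linarith
  then have "prob {\<omega> \<in> space M. \<bar>X \<omega> - e\<bar> > t} \<le> prob (\<Omega>x \<union> {\<omega> \<in> space M - \<Omega>x. u \<le> \<bar>X \<omega> - m\<bar>})"
    by (intro finite_measure_mono) auto
  also have "\<dots> \<le> p + prob {\<omega> \<in> space M - \<Omega>x. u \<le> \<bar>X \<omega> - m\<bar>}"
    unfolding p_def by (intro measure_Un_le) auto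
  also have "\<dots> \<le> 4 * p + 4 * exp (- y)"
    using tail[OF \<open>u > 0\<close>] e1 \<open>p \<ge> 0\<close> by linarith
  finally show ?thesis
    by (simp add: y_def e_def p_def)
qed

end

lemma tendsto_exp_neg_div_at_right_0:
  fixes c :: real
  assumes "c > 0"
  shows "((\<lambda>k. exp (- c / k)) \<longlongrightarrow> 0) (at_right 0)"
proof -
  have "filterlim (\<lambda>k. - c * inverse k) at_bot (at_right 0)"
    using assms by (intro filterlim_tendsto_neg_mult_at_bot[OF tendsto_const _ filterlim_inverse_at_top_right]) auto
  then have "((\<lambda>k. exp (- c * inverse k)) \<longlongrightarrow> 0) (at_right 0)"
    by (rule filterlim_compose[OF exp_at_bot])
  then show ?thesis by (simp add: field_simps)
qed

theorem theorem4p4: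
  fixes n :: nat
    and M :: "nat \<Rightarrow> 'a measure"
    and P :: "(nat \<Rightarrow> 'a) measure"
    and \<Omega>x :: "(nat \<Rightarrow> 'a) set"
    and X :: "(nat \<Rightarrow> 'a) \<Rightarrow> real"
    and r d t :: real
  defines "P \<equiv> PiM {1..n} M"
  assumes "\<And>i. i \<in> {1..n} \<Longrightarrow> prob_space (M i)"
    and "\<Omega>x \<in> sets P"
    and "X \<in> borel_measurable P"
    and "\<And>\<omega>. \<omega> \<in> space P \<Longrightarrow> X \<omega> \<ge> 0"
    and "r \<ge> 0" and "d \<ge> 0"
    and "observable n (space P) \<Omega>x X r d"
    and "ereal t > ereal (96 * sqrt (r * d * (\<integral>\<omega>. X \<omega> \<partial>P)) + 128 * r * d)
                    + 8 * ereal (measure P \<Omega>x) * sup_over (space P) X"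
  shows "measure P {\<omega> \<in> space P. \<bar>X \<omega> - (\<integral>\<omega>. X \<omega> \<partial>P)\<bar> > t}
           \<le> 4 * exp_neg_quot (t\<^sup>2) (8 * r * d * (4 * (\<integral>\<omega>. X \<omega> \<partial>P) + t)) + 4 * measure P \<Omega>x"
proof -
  interpret P: prob_space P
    unfolding P_def by (rule prob_space_PiM) (use assms(2) in auto)
  define e where "e = (\<integral>\<omega>. X \<omega> \<partial>P)"
  define p where "p = measure P \<Omega>x"
  define tail where "tail = measure P {\<omega> \<in> space P. \<bar>X \<omega> - e\<bar> > t}"
  have "e \<ge> 0"
    unfolding e_def by (intro Bochner_Integration.integral_nonneg_AE AE_I2 assms(5))
  have "p \<ge> 0" by (simp add: p_def)
  \<comment> \<open>If \<open>p = 0\<close>, the supremum may be infinite, but its term is 0 in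
    \<open>ereal\<close> and \<open>S = 0\<close> will do. If \<open>p > 0\<close>, finiteness of
    \<open>t\<close> forces a finite supremum.\<close>
  obtain S where S: "S \<ge> 0" "p = 0 \<or> (\<forall>\<omega>\<in>space P. X \<omega> \<le> S)"
    and t: "t > 96 * sqrt (r * d * e) + 128 * (r * d) + 8 * p * S"
  proof (cases "p = 0")
    case True
    then have "t > 96 * sqrt (r * d * e) + 128 * (r * d) + 8 * p * 0"
      using assms(9) by (simp add: e_def p_def mult.assoc flip: zero_ereal_def)
    with True show ?thesis by (intro that[of 0]) auto
  next
    case False
    with \<open>p \<ge> 0\<close> have "p > 0" by simp
    have le: "ereal (X \<omega>) \<le> sup_over (space P) X" if "\<omega> \<in> space P" for \<omega>
      unfolding sup_over_def using that by (rule SUP_upper)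
    obtain \<omega>0 where "\<omega>0 \<in> space P" using P.not_empty by blast
    have "ereal 0 \<le> ereal (X \<omega>0)" using assms(5)[OF \<open>\<omega>0 \<in> space P\<close>] by simp
    also note le[OF \<open>\<omega>0 \<in> space P\<close>]
    finally have nonneg: "ereal 0 \<le> sup_over (space P) X" .
    have "sup_over (space P) X \<noteq> \<infinity>"
      using assms(9) \<open>p > 0\<close> by (auto simp: p_def)
    with nonneg obtain S where S: "sup_over (space P) X = ereal S"
      by (cases "sup_over (space P) X") auto
    have "ereal t > ereal (96 * sqrt (r * d * e) + 128 * (r * d)) + 8 * ereal p * ereal S"
      using assms(9) by (simp only: e_def p_def S mult.assoc)
    also have "ereal (96 * sqrt (r * d * e) + 128 * (r * d)) + 8 * ereal p * ereal S =
        ereal (96 * sqrt (r * d * e) + 128 * (r * d) + 8 * p * S)"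
      by simp
    finally show ?thesis
      using nonneg le S by (intro that[of S]) auto
  qed
  have bound: "tail \<le> 4 * exp (- t\<^sup>2 / (8 * (r' * d') * (4 * e + t))) + 4 * p"
    if "r \<le> r'" "d \<le> d'" "r' > 0" "d' > 0"
      and t': "t > 96 * sqrt (r' * d' * e) + 128 * (r' * d') + 8 * p * S" for r' d'
    unfolding tail_def e_def p_def
  proof (rule P.two_sets_concentration[OF assms(4,3,5)])
    fix a s :: real assume "s > 0" "a \<le> s"
    then show "measure P {\<omega> \<in> space P - \<Omega>x. X \<omega> \<le> a} * measure P {\<omega> \<in> space P - \<Omega>x. s \<le> X \<omega>} \<le>
        exp (- (s - a)\<^sup>2 / (4 * (r' * d') * s))"
      using assms(2,3,4) observable_mono[OF assms(8) that(1,2)] that(3,4) unfolding P_def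
      by (intro observable_two_sets)
  qed (use that S t' in \<open>auto simp: p_def e_def\<close>)
  have "0 \<le> 96 * sqrt (r * d * e) + 128 * (r * d) + 8 * p * S"
    using \<open>e \<ge> 0\<close> \<open>p \<ge> 0\<close> S(1) assms(6,7) by simp
  with t have "t > 0" by linarith
  show ?thesis
  proof (cases "r * d = 0")
    case False
    then have "r > 0" "d > 0" using assms(6,7) by (auto simp: less_le)
    then have "8 * r * d * (4 * e + t) \<noteq> 0"
      using \<open>e \<ge> 0\<close> \<open>t > 0\<close> by simp
    with bound[OF order_refl order_refl \<open>r > 0\<close> \<open>d > 0\<close> t] show ?thesis
      by (simp add: tail_def e_def p_def exp_neg_quot_def mult.assoc)
  next

    \<comment> \<open>The limit for vanishing \<open>r * d\<close>\<close>
    case True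
    define \<kappa> where "\<kappa> \<epsilon> = (r + \<epsilon>) * (d + \<epsilon>)" for \<epsilon>
    have \<kappa>_pos: "\<kappa> \<epsilon> > 0" if "\<epsilon> > 0" for \<epsilon>
      using that assms(6,7) by (simp add: \<kappa>_def add_nonneg_pos)
    have "(\<kappa> \<longlongrightarrow> (r + 0) * (d + 0)) (at_right 0)"
      unfolding \<kappa>_def by (intro tendsto_intros)
    then have \<kappa>0: "(\<kappa> \<longlongrightarrow> 0) (at_right 0)" using True by simp
    have "((\<lambda>\<epsilon>. 96 * sqrt (\<kappa> \<epsilon> * e) + 128 * \<kappa> \<epsilon> + 8 * p * S) \<longlongrightarrow>
        96 * sqrt (0 * e) + 128 * 0 + 8 * p * S) (at_right 0)"
      by (intro tendsto_intros \<kappa>0)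
    \<comment> \<open>The hypothesis on \<open>t\<close> is strict, so it survives small
      enlargements of \<open>r\<close> and \<open>d\<close>.\<close>
    then have "eventually (\<lambda>\<epsilon>. 96 * sqrt (\<kappa> \<epsilon> * e) + 128 * \<kappa> \<epsilon> + 8 * p * S < t) (at_right 0)"
      by (rule order_tendstoD) (use t True in simp)
    then have ev: "eventually (\<lambda>\<epsilon>. tail \<le> 4 * exp (- (t\<^sup>2 / (8 * (4 * e + t))) / \<kappa> \<epsilon>) + 4 * p) (at_right 0)"
      using eventually_at_right_less[of 0]
    proof eventually_elim
      case (elim \<epsilon>)
      have "tail \<le> 4 * exp (- t\<^sup>2 / (8 * ((r + \<epsilon>) * (d + \<epsilon>)) * (4 * e + t))) + 4 * p"
        using elim assms(6,7) by (intro bound) (auto simp: \<kappa>_def)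
      also have "- t\<^sup>2 / (8 * ((r + \<epsilon>) * (d + \<epsilon>)) * (4 * e + t)) = - (t\<^sup>2 / (8 * (4 * e + t))) / \<kappa> \<epsilon>"
        by (simp only: \<kappa>_def minus_divide_left divide_divide_eq_left mult_ac)
      finally show ?case .
    qed
    have "filterlim \<kappa> (at_right 0) (at_right 0)"
      using \<kappa>0 \<kappa>_pos by (intro tendsto_imp_filterlim_at_right)
        (auto intro: eventually_at_right_less[THEN eventually_mono])
    then have "((\<lambda>\<epsilon>. exp (- (t\<^sup>2 / (8 * (4 * e + t))) / \<kappa> \<epsilon>)) \<longlongrightarrow> 0) (at_right 0)"
      using \<open>t > 0\<close> \<open>e \<ge> 0\<close>
      by (intro filterlim_compose[OF tendsto_exp_neg_div_at_right_0]) (auto intro!: divide_pos_pos)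
    then have "((\<lambda>\<epsilon>. 4 * exp (- (t\<^sup>2 / (8 * (4 * e + t))) / \<kappa> \<epsilon>) + 4 * p) \<longlongrightarrow> 4 * 0 + 4 * p) (at_right 0)"
      by (intro tendsto_intros)
    then have "tail \<le> 4 * 0 + 4 * p"
      by (rule tendsto_lowerbound[OF _ ev]) simp
    then show ?thesis
      \<comment> \<open>At denominator 0 \<open>exp_neg_quot\<close> is 0, which is exactly the
        limit of the exponentials.\<close>
      using True by (auto simp: tail_def e_def p_def exp_neg_quot_def)
  qed
qed

end
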